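(* Let $\Gamma$ be a transvection-free graph. Then $A_\Gamma$ has the $R_\infty$-property.
   Context: A graph is a finite simple non-empty graph $\Gamma(V,E)$. The right-angled Artin group associated to $\Gamma$ is $A_\Gamma=\langle V \mid [v,w],\ vw\in E\rangle$. For $v\in V$, the link $lk(v)$ is the set of vertices adjacent to $v$, and the star is $st(v)=lk(v)\cup\{v\}$. Write $v\le w$ if $lk(v)\subseteq st(w)$. A vertex $v$ is transvection-free if $\{w\in V\mid v\le w\}=\{v\}$. The graph $\Gamma$ is transvection-free if $\Gamma$ is not the one-vertex graph $K^1$ and every vertex of $\Gamma$ is transvection-free. For a group $G$ and $\varphi\in\operatorname{Aut}(G)$, elements $x,y\in G$ are $\varphi$-conjugate if $x=gy\varphi(g)^{-1}$ for some $g\in G$; the Reidemeister number $R(\varphi)$ is the number of $\varphi$-conjugacy classes ($\infty$ if there are infinitely many). $G$ has the $R_\infty$-property if $R(\varphi)=\infty$ for all $\varphi\in\operatorname{Aut}(G)$. *)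

theory Defs
  imports "HOL-Algebra.Bij" "Graph_Theory.Pair_Digraph" "HOL-Library.Extended_Nat"
begin

section \<open>Groups given by a presentation\<close>

text \<open>
  A letter \<open>(x, True)\<close> stands for the generator \<open>x\<close> and \<open>(x, False)\<close> for its formal inverse.
\<close>

type_synonym 'a word = "('a \<times> bool) list"

definition words_over :: "'a set \<Rightarrow> 'a word set" where
  "words_over S = {w. fst ` set w \<subseteq> S}"

text \<open>
  The least congruence on the words over \<open>S\<close> that cancels mutually inverse adjacent letters and
  makes every relator trivial.
\<close>

inductive_set pres_cong :: "'a set \<Rightarrow> 'a word set \<Rightarrow> ('a word \<times> 'a word) set"
  for S :: "'a set" and R :: "'a word set" where
  cancel: "x \<in> S \<Longrightarrow> ([(x, b), (x, \<not> b)], []) \<in> pres_cong S R"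
| relator: "r \<in> R \<Longrightarrow> r \<in> words_over S \<Longrightarrow> (r, []) \<in> pres_cong S R"
| refl: "u \<in> words_over S \<Longrightarrow> (u, u) \<in> pres_cong S R"
| sym: "(u, v) \<in> pres_cong S R \<Longrightarrow> (v, u) \<in> pres_cong S R"
| trans: "(u, v) \<in> pres_cong S R \<Longrightarrow> (v, w) \<in> pres_cong S R \<Longrightarrow> (u, w) \<in> pres_cong S R"
| append: "(u, u') \<in> pres_cong S R \<Longrightarrow> (v, v') \<in> pres_cong S R
    \<Longrightarrow> (u @ v, u' @ v') \<in> pres_cong S R"

definition presented_group :: "'a set \<Rightarrow> 'a word set \<Rightarrow> 'a word set monoid" where
  "presented_group S R =
    \<lparr>carrier = words_over S // pres_cong S R,
     monoid.mult = \<lambda>A B. pres_cong S R `` {u @ v | u v. u \<in> A \<and> v \<in> B},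
     one = pres_cong S R `` {[]}\<rparr>"

lemma pres_cong_in_words:
  "(u, v) \<in> pres_cong S R \<Longrightarrow> u \<in> words_over S \<and> v \<in> words_over S"
  by (induction rule: pres_cong.induct) (auto simp: words_over_def)

lemma equiv_pres_cong: "equiv (words_over S) (pres_cong S R)"
proof (rule equivI)
  show "pres_cong S R \<subseteq> words_over S \<times> words_over S"
    using pres_cong_in_words by fastforce
  show "refl_on (words_over S) (pres_cong S R)"
    by (auto intro!: refl_onI pres_cong.refl dest: pres_cong_in_words)
  show "sym (pres_cong S R)" by (auto intro!: symI pres_cong.sym)
  show "trans (pres_cong S R)" by (auto intro!: transI elim: pres_cong.trans)
qed

lemma presented_group_mult_class:
  assumes "u \<in> words_over S" "v \<in> words_over S"
  shows "pres_cong S R `` {u} \<otimes>\<^bsub>presented_group S R\<^esub> pres_cong S R `` {v}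
    = pres_cong S R `` {u @ v}"
  using assms
  by (auto simp: presented_group_def
      intro: pres_cong.trans pres_cong.append pres_cong.refl)

lemma presented_group_inverse_word:
  assumes "u \<in> words_over S"
  shows "(rev (map (\<lambda>(x, b). (x, \<not> b)) u) @ u, []) \<in> pres_cong S R"
  using assms
proof (induction u)
  case Nil
  then show ?case by (simp add: pres_cong.refl)
next
  case (Cons a u)
  obtain x b where a: "a = (x, b)" by (cases a)
  let ?i = "\<lambda>w. rev (map (\<lambda>(x, b). (x, \<not> b)) w)"
  have x: "x \<in> S" and u: "u \<in> words_over S"
    using Cons.prems by (auto simp: a words_over_def)
  have i: "?i u \<in> words_over S" using u by (auto simp: words_over_def)
  have "([(x, \<not> b), (x, \<not> \<not> b)] @ u, [] @ u) \<in> pres_cong S R"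
    by (intro pres_cong.append pres_cong.cancel pres_cong.refl x u)
  then have "(?i u @ [(x, \<not> b), (x, b)] @ u, ?i u @ u) \<in> pres_cong S R"
    using pres_cong.append[OF pres_cong.refl[OF i]] by fastforce
  from pres_cong.trans[OF this Cons.IH[OF u]] show ?case by (simp add: a)
qed

lemma presented_group_is_group: "group (presented_group S R)" (is "group ?G")
proof -
  let ?c = "\<lambda>u. pres_cong S R `` {u}"
  have car: "A \<in> carrier ?G \<longleftrightarrow> (\<exists>u\<in>words_over S. A = ?c u)" for A
    by (auto simp: presented_group_def quotient_def)
  have one: "\<one>\<^bsub>?G\<^esub> = ?c []" by (simp add: presented_group_def)
  have nil: "[] \<in> words_over S" by (simp add: words_over_def)
  have app: "u @ v \<in> words_over S" if "u \<in> words_over S" "v \<in> words_over S" for u v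
    using that by (auto simp: words_over_def)
  show ?thesis
  proof (rule groupI)
    show "\<one>\<^bsub>?G\<^esub> \<in> carrier ?G" using nil by (auto simp: car one)
  next
    fix A B assume "A \<in> carrier ?G" "B \<in> carrier ?G"
    then show "A \<otimes>\<^bsub>?G\<^esub> B \<in> carrier ?G"
      by (auto simp: car presented_group_mult_class intro: app)
  next
    fix A B C assume "A \<in> carrier ?G" "B \<in> carrier ?G" "C \<in> carrier ?G"
    then show "A \<otimes>\<^bsub>?G\<^esub> B \<otimes>\<^bsub>?G\<^esub> C = A \<otimes>\<^bsub>?G\<^esub> (B \<otimes>\<^bsub>?G\<^esub> C)"
      by (auto simp: car presented_group_mult_class app)
  next
    fix A assume "A \<in> carrier ?G"
    then show "\<one>\<^bsub>?G\<^esub> \<otimes>\<^bsub>?G\<^esub> A = A"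
      by (auto simp: car one presented_group_mult_class nil)
  next
    fix A assume "A \<in> carrier ?G"
    then obtain u where u: "u \<in> words_over S" "A = ?c u" by (auto simp: car)
    let ?i = "rev (map (\<lambda>(x, b). (x, \<not> b)) u)"
    have i: "?i \<in> words_over S" using u(1) by (auto simp: words_over_def)
    have "?c ?i \<otimes>\<^bsub>?G\<^esub> A = \<one>\<^bsub>?G\<^esub>"
      unfolding u(2) presented_group_mult_class[OF i u(1)] one
      by (rule equiv_class_eq[OF equiv_pres_cong presented_group_inverse_word[OF u(1)]])
    then show "\<exists>B\<in>carrier ?G. B \<otimes>\<^bsub>?G\<^esub> A = \<one>\<^bsub>?G\<^esub>" using i by (intro bexI[of _ "?c ?i"]) (auto simp: car)
  qed
qed


section \<open>Right-angled Artin groups\<close>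

text \<open>
  A finite simple graph is a \<^const>\<open>pair_graph\<close>: an undirected edge between \<open>v\<close> and \<open>w\<close> is
  represented by both arcs \<open>(v, w)\<close> and \<open>(w, v)\<close>. These structures may be empty.
\<close>

definition raag :: "'a pair_pre_digraph \<Rightarrow> 'a word set monoid" where
  "raag \<Gamma> = presented_group (pverts \<Gamma>)
     {[(v, True), (w, True), (v, False), (w, False)] | v w. (v, w) \<in> parcs \<Gamma>}"

definition link :: "'a pair_pre_digraph \<Rightarrow> 'a \<Rightarrow> 'a set" where
  "link \<Gamma> v = {w \<in> pverts \<Gamma>. (v, w) \<in> parcs \<Gamma>}"

definition star :: "'a pair_pre_digraph \<Rightarrow> 'a \<Rightarrow> 'a set" where
  "star \<Gamma> v = link \<Gamma> v \<union> {v}"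

definition vertex_le :: "'a pair_pre_digraph \<Rightarrow> 'a \<Rightarrow> 'a \<Rightarrow> bool" where
  "vertex_le \<Gamma> v w \<longleftrightarrow> link \<Gamma> v \<subseteq> star \<Gamma> w"

definition transvection_free_vertex :: "'a pair_pre_digraph \<Rightarrow> 'a \<Rightarrow> bool" where
  "transvection_free_vertex \<Gamma> v \<longleftrightarrow> {w \<in> pverts \<Gamma>. vertex_le \<Gamma> v w} = {v}"

definition transvection_free :: "'a pair_pre_digraph \<Rightarrow> bool" where
  "transvection_free \<Gamma> \<longleftrightarrow>
     card (pverts \<Gamma>) \<noteq> 1 \<and> (\<forall>v\<in>pverts \<Gamma>. transvection_free_vertex \<Gamma> v)"


section \<open>Twisted conjugacy\<close>

definition twisted_conj :: "('a, 'b) monoid_scheme \<Rightarrow> ('a \<Rightarrow> 'a) \<Rightarrow> ('a \<times> 'a) set" where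
  "twisted_conj G \<phi> = {(x, y). x \<in> carrier G \<and> y \<in> carrier G \<and>
     (\<exists>g\<in>carrier G. x = g \<otimes>\<^bsub>G\<^esub> y \<otimes>\<^bsub>G\<^esub> inv\<^bsub>G\<^esub> (\<phi> g))}"

definition reidemeister_number :: "('a, 'b) monoid_scheme \<Rightarrow> ('a \<Rightarrow> 'a) \<Rightarrow> enat" where
  "reidemeister_number G \<phi> =
     (if finite (carrier G // twisted_conj G \<phi>)
      then enat (card (carrier G // twisted_conj G \<phi>)) else \<infinity>)"

definition R_infinity_property :: "('a, 'b) monoid_scheme \<Rightarrow> bool" where
  "R_infinity_property G \<longleftrightarrow> (\<forall>\<phi>\<in>auto G. reidemeister_number G \<phi> = \<infinity>)"

end

theory Submission
  imports Defs "HOL-Combinatorics.Cycles"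
begin

text \<open>
  Let \<open>\<phi>\<close> be an automorphism of the group. The Magnus map sends a vertex \<open>v\<close> to \<open>1 + v\<close> in
  the ring of power series in the vertices, where adjacent vertices commute and no other relations
  hold. The order of \<open>g - 1\<close> in this ring filters the group, and \<open>\<phi>\<close> extends to a substitution on
  series that preserves the filtration and acts on each graded piece through the integral matrix that
  \<open>\<phi>\<close> induces in degree one (\<open>magnus_word_subst\<close>, \<open>subst_leading\<close>).

  Adjacent vertices commute, so the linear parts of their images commute in degree two, and the same
  holds for the inverse automorphism. When no vertex \<open>v\<close> satisfies \<open>v \<le> w\<close> for another
  vertex \<open>w\<close>, linear algebra with these conditions shows that the matrix is a signed permutation
  matrix whose permutation is a symmetry of the graph (\<open>inverse_pair_signed_permutation\<close>).

  So \<open>\<phi>\<close> acts on every graded piece with a finite order \<open>N\<close>. There is a degree in which some group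
  element has a leading part whose sum over the orbit of this action is not zero: take non-adjacent
  vertices \<open>v\<close> and \<open>w\<close> and a commutator of degree two in \<open>v\<close> and four in \<open>w\<close>. As both numbers are
  even, signs cannot cancel terms of the orbit sum, and as they are distinct, neither can an exchange
  of vertices (\<open>norm_test_word\<close>). In the least such degree pick an element \<open>a\<close> with leading part
  \<open>h\<close>. A twisted conjugation of \<open>a ^ j\<close> into \<open>a ^ i\<close> by \<open>g\<close> forces \<open>g\<close> down to that degree, where it
  yields \<open>(i - j) h = f - \<phi> f\<close>. The orbit sum of the right-hand side is zero, hence \<open>i = j\<close>
  (\<open>twisted_classes_of_powers\<close>). Thus the powers of \<open>a\<close> lie in infinitely many twisted conjugacy
  classes.
\<close>

section \<open>Power series in non-commuting variables\<close>

text \<open>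
  The Magnus map needs inverses of \<open>1 + v\<close>, so power series are used rather than polynomials. The
  variables do not commute at all, which makes the ring independent of the graph; the commutation
  relations enter later, through the filtration.
\<close>

typedef 'a series = "UNIV :: ('a list \<Rightarrow> int) set"
  morphisms coeff series ..

setup_lifting type_definition_series

lemma coeff_series [simp]: "coeff (series c) u = c u"
  by (simp add: series_inverse)

lemma series_eqI: "(\<And>u. coeff f u = coeff g u) \<Longrightarrow> f = g"
  by (simp add: coeff_inject[symmetric] fun_eq_iff)

definition splits :: "'a list \<Rightarrow> ('a list \<times> 'a list) set" where
  "splits u = {(a, b). a @ b = u}"

lemma mem_splits [simp]: "(a, b) \<in> splits u \<longleftrightarrow> a @ b = u"
  by (simp add: splits_def)

lemma splits_eq_image: "splits u = (\<lambda>i. (take i u, drop i u)) ` {..length u}"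
proof -
  have "(a, b) \<in> (\<lambda>i. (take i u, drop i u)) ` {..length u}" if "a @ b = u" for a b
    using that by (intro image_eqI[of _ _ "length a"]) auto
  then show ?thesis by (auto simp: splits_def)
qed

lemma finite_splits [simp]: "finite (splits u)"
  by (simp add: splits_eq_image)

lemma splits_Nil [simp]: "splits [] = {([], [])}"
  by (auto simp: splits_def)

instantiation series :: (type) ring_1
begin

lift_definition zero_series :: "'a series" is "\<lambda>_. 0" .
lift_definition one_series :: "'a series" is "\<lambda>u. if u = [] then 1 else 0" .
lift_definition plus_series :: "'a series \<Rightarrow> 'a series \<Rightarrow> 'a series" is "\<lambda>f g u. f u + g u" .
lift_definition minus_series :: "'a series \<Rightarrow> 'a series \<Rightarrow> 'a series" is "\<lambda>f g u. f u - g u" .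
lift_definition uminus_series :: "'a series \<Rightarrow> 'a series" is "\<lambda>f u. - f u" .
lift_definition times_series :: "'a series \<Rightarrow> 'a series \<Rightarrow> 'a series"
  is "\<lambda>f g u. \<Sum>(a, b)\<in>splits u. f a * g b" .

instance
proof
  fix f g h :: "'a series"
  show "f * g * h = f * (g * h)"
  proof (rule series_eqI)
    fix u
    have "coeff (f * g * h) u
      = (\<Sum>(x, c)\<in>splits u. \<Sum>(a, b)\<in>splits x. coeff f a * coeff g b * coeff h c)"
      by (simp add: times_series.rep_eq sum_distrib_right case_prod_beta)
    also have "\<dots> = (\<Sum>((x, c), (a, b))\<in>Sigma (splits u) (\<lambda>p. splits (fst p)).
        coeff f a * coeff g b * coeff h c)"
      by (subst sum.Sigma[symmetric]) (auto simp: case_prod_beta)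
    also have "\<dots> = (\<Sum>((a, y), (b, c))\<in>Sigma (splits u) (\<lambda>p. splits (snd p)).
        coeff f a * coeff g b * coeff h c)"
      by (rule sum.reindex_bij_witness[where i = "\<lambda>((a, y), (b, c)). ((a @ b, c), (a, b))"
            and j = "\<lambda>((x, c), (a, b)). ((a, b @ c), (b, c))"])
        auto
    also have "\<dots> = (\<Sum>(a, y)\<in>splits u. \<Sum>(b, c)\<in>splits y. coeff f a * coeff g b * coeff h c)"
      by (subst sum.Sigma[symmetric]) (auto simp: case_prod_beta)
    also have "\<dots> = coeff (f * (g * h)) u"
      by (simp add: times_series.rep_eq sum_distrib_left case_prod_beta mult.assoc)
    finally show "coeff (f * g * h) u = coeff (f * (g * h)) u" .
  qed
  show "1 * f = f"
  proof (rule series_eqI)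
    fix u
    have "coeff (1 * f) u = (\<Sum>p\<in>splits u. if p = ([], u) then coeff f u else 0)"
      unfolding times_series.rep_eq one_series.rep_eq
      by (rule sum.cong) (auto split: if_splits)
    then show "coeff (1 * f) u = coeff f u" by simp
  qed
  show "f * 1 = f"
  proof (rule series_eqI)
    fix u
    have "coeff (f * 1) u = (\<Sum>p\<in>splits u. if p = (u, []) then coeff f u else 0)"
      unfolding times_series.rep_eq one_series.rep_eq
      by (rule sum.cong) (auto split: if_splits)
    then show "coeff (f * 1) u = coeff f u" by simp
  qed
  show "(f + g) * h = f * h + g * h" "f * (g + h) = f * g + f * h"
    by (rule series_eqI, simp add: times_series.rep_eq plus_series.rep_eq case_prod_beta
        algebra_simps sum.distrib)+
  show "(0 :: 'a series) \<noteq> 1"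
  proof
    assume "(0 :: 'a series) = 1"
    then have "coeff (0 :: 'a series) [] = coeff 1 []" by simp
    then show False by (simp add: zero_series.rep_eq one_series.rep_eq)
  qed
qed (rule series_eqI,
    simp add: plus_series.rep_eq minus_series.rep_eq uminus_series.rep_eq zero_series.rep_eq)+

end

lemmas coeff_mult = times_series.rep_eq

lemma coeff_add [simp]: "coeff (f + g) u = coeff f u + coeff g u"
  and coeff_diff [simp]: "coeff (f - g) u = coeff f u - coeff g u"
  and coeff_uminus [simp]: "coeff (- f) u = - coeff f u"
  and coeff_zero [simp]: "coeff 0 u = 0"
  and coeff_one: "coeff 1 u = (if u = [] then 1 else 0)"
  by (simp_all add: plus_series.rep_eq minus_series.rep_eq uminus_series.rep_eq
      zero_series.rep_eq one_series.rep_eq)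

lemma coeff_sum: "coeff (\<Sum>i\<in>I. f i) u = (\<Sum>i\<in>I. coeff (f i) u)"
  by (induction I rule: infinite_finite_induct) auto

lemma coeff_of_nat_mult: "coeff (of_nat n * f) u = int n * coeff f u"
  by (induction n) (simp_all add: algebra_simps)

lemma coeff_of_int_mult: "coeff (of_int n * f) u = n * coeff f u"
  by (cases n) (simp_all add: coeff_of_nat_mult algebra_simps del: of_nat_Suc)

lemma coeff_mult_Nil [simp]: "coeff (f * g) [] = coeff f [] * coeff g []"
  by (simp add: coeff_mult)

section \<open>The Magnus map\<close>

definition var :: "'a \<Rightarrow> 'a series" where
  "var v = series (\<lambda>u. if u = [v] then 1 else 0)"

definition var_inv :: "'a \<Rightarrow> 'a series" where
  "var_inv v = series (\<lambda>u. if set u \<subseteq> {v} then (- 1) ^ length u else 0)"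

lemma coeff_var: "coeff (var v) u = (if u = [v] then 1 else 0)"
  by (simp add: var_def)

lemma coeff_var_mult: "coeff (var v * f) u = (case u of [] \<Rightarrow> 0 | x # b \<Rightarrow> if x = v then coeff f b else 0)"
proof -
  have "coeff (var v * f) u
    = (\<Sum>p\<in>splits u. if p = ([v], tl u) then coeff f (tl u) else 0)"
    unfolding coeff_mult coeff_var by (rule sum.cong) (auto split: if_splits)
  then show ?thesis by (auto split: list.split)
qed

lemma coeff_mult_var: "coeff (f * var v) u = (if u \<noteq> [] \<and> last u = v then coeff f (butlast u) else 0)"
proof -
  have "coeff (f * var v) u
    = (\<Sum>p\<in>splits u. if p = (butlast u, [v]) then coeff f (butlast u) else 0)"
    unfolding coeff_mult coeff_var by (rule sum.cong) (auto split: if_splits)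
  then show ?thesis by (cases u rule: rev_cases) auto
qed

lemma var_inv_right: "(1 + var v) * var_inv v = 1"
proof (rule series_eqI)
  fix u show "coeff ((1 + var v) * var_inv v) u = coeff 1 u"
    by (cases u) (auto simp: distrib_right coeff_var_mult coeff_var var_inv_def coeff_one)
qed

lemma var_inv_left: "var_inv v * (1 + var v) = 1"
proof (rule series_eqI)
  fix u show "coeff (var_inv v * (1 + var v)) u = coeff 1 u"
    by (cases u rule: rev_cases) (auto simp: distrib_left coeff_mult_var coeff_var var_inv_def coeff_one)
qed

fun magnus_letter :: "'a \<times> bool \<Rightarrow> 'a series" where
  "magnus_letter (v, b) = (if b then 1 + var v else var_inv v)"

definition magnus :: "'a word \<Rightarrow> 'a series" where
  "magnus w = prod_list (map magnus_letter w)"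

lemma magnus_Nil [simp]: "magnus [] = 1"
  and magnus_Cons [simp]: "magnus (x # w) = magnus_letter x * magnus w"
  and magnus_append [simp]: "magnus (w @ w') = magnus w * magnus w'"
  by (simp_all add: magnus_def)

lemma magnus_letter_cancel: "magnus_letter (v, b) * magnus_letter (v, \<not> b) = 1"
  by (simp add: var_inv_left var_inv_right)

lemma coeff_magnus_Nil [simp]: "coeff (magnus w) [] = 1"
  by (induction w) (auto simp: coeff_one coeff_var var_inv_def)

definition inv_word :: "'a word \<Rightarrow> 'a word" where
  "inv_word w = rev (map (\<lambda>(x, b). (x, \<not> b)) w)"

lemma inv_word_words_over [simp]: "inv_word w \<in> words_over V \<longleftrightarrow> w \<in> words_over V"
  by (auto simp: inv_word_def words_over_def image_image case_prod_beta)

lemma magnus_inv_left: "magnus (inv_word w) * magnus w = 1"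
proof (induction w)
  case (Cons l w)
  obtain x b where l: "l = (x, b)" by (cases l)
  have "magnus (inv_word (l # w)) * magnus (l # w)
    = magnus (inv_word w) * (magnus_letter (x, \<not> b) * magnus_letter (x, \<not> \<not> b)) * magnus w"
    by (simp add: inv_word_def l mult.assoc)
  also have "\<dots> = 1" unfolding magnus_letter_cancel using Cons by simp
  finally show ?case .
qed (simp add: inv_word_def)

lemma inv_word_inv_word [simp]: "inv_word (inv_word w) = w"
  by (simp add: inv_word_def rev_map case_prod_beta comp_def)

lemma magnus_inv_right: "magnus w * magnus (inv_word w) = 1"
  using magnus_inv_left[of "inv_word w"] by simp

section \<open>Order of a series and leading terms\<close>

definition order_ge :: "nat \<Rightarrow> 'a series \<Rightarrow> bool" where
  "order_ge n f \<longleftrightarrow> (\<forall>u. length u < n \<longrightarrow> coeff f u = 0)"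

lemma order_ge_coeff: "order_ge n f \<Longrightarrow> length u < n \<Longrightarrow> coeff f u = 0"
  by (simp add: order_ge_def)

lemma order_ge_mult: "order_ge m f \<Longrightarrow> order_ge n g \<Longrightarrow> order_ge (m + n) (f * g)"
  unfolding order_ge_def coeff_mult
proof (intro allI impI sum.neutral ballI)
  fix u :: "'a list" and p
  assume f: "\<forall>u. length u < m \<longrightarrow> coeff f u = 0" and g: "\<forall>u. length u < n \<longrightarrow> coeff g u = 0"
    and "length u < m + n" "p \<in> splits u"
  then obtain a b where p: "p = (a, b)" "length a + length b < m + n"
    by (auto simp: splits_def)
  then have "length a < m \<or> length b < n" by linarith
  then show "(case p of (a, b) \<Rightarrow> coeff f a * coeff g b) = 0" using f g by (auto simp: p)
qed

lemma coeff_mult_leading: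
  assumes f: "order_ge m f" and g: "order_ge n g" and "length u = m + n"
  shows "coeff (f * g) u = coeff f (take m u) * coeff g (drop m u)"
proof -
  have "coeff (f * g) u = (\<Sum>p\<in>splits u. if p = (take m u, drop m u)
      then coeff f (take m u) * coeff g (drop m u) else 0)"
    unfolding coeff_mult
  proof (rule sum.cong[OF HOL.refl])
    fix p assume "p \<in> splits u"
    then obtain a b where p: "p = (a, b)" "u = a @ b" by (auto simp: splits_def)
    then consider "length a = m" | "length a < m" | "length b < n" using assms(3) by fastforce
    then show "(case p of (a, b) \<Rightarrow> coeff f a * coeff g b) = (if p = (take m u, drop m u)
      then coeff f (take m u) * coeff g (drop m u) else 0)"
    proof cases
      case 1 then show ?thesis by (simp add: p)
    next
      case 2
      then show ?thesis using order_ge_coeff[OF f 2] by (auto simp: p)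
    next
      case 3
      then have "length a \<noteq> length (take m u)" using assms(3) by (simp add: p)
      then have "a \<noteq> take m u" by metis
      then show ?thesis using order_ge_coeff[OF g 3] by (auto simp: p)
    qed
  qed
  also have "\<dots> = coeff f (take m u) * coeff g (drop m u)"
    by simp
  finally show ?thesis .
qed

section \<open>Substitution\<close>

definition monomial :: "('a \<Rightarrow> 'a series) \<Rightarrow> 'a list \<Rightarrow> 'a series" where
  "monomial Y t = prod_list (map Y t)"

lemma monomial_Nil [simp]: "monomial Y [] = 1"
  and monomial_Cons [simp]: "monomial Y (x # t) = Y x * monomial Y t"
  and monomial_append: "monomial Y (s @ t) = monomial Y s * monomial Y t"
  by (simp_all add: monomial_def)

definition short_lists :: "'a set \<Rightarrow> nat \<Rightarrow> 'a list set" where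
  "short_lists V n = {t. set t \<subseteq> V \<and> length t \<le> n}"

lemma finite_short_lists [simp]: "finite V \<Longrightarrow> finite (short_lists V n)"
  by (simp add: short_lists_def finite_lists_length_le)

definition subst :: "'a set \<Rightarrow> ('a \<Rightarrow> 'a series) \<Rightarrow> 'a series \<Rightarrow> 'a series" where
  "subst V Y f = series (\<lambda>u. \<Sum>t\<in>short_lists V (length u). coeff f t * coeff (monomial Y t) u)"

lemma coeff_subst:
  "coeff (subst V Y f) u = (\<Sum>t\<in>short_lists V (length u). coeff f t * coeff (monomial Y t) u)"
  by (simp add: subst_def)

lemma order_ge_monomial:
  assumes "\<And>v. v \<in> V \<Longrightarrow> coeff (Y v) [] = 0" and "set t \<subseteq> V"
  shows "order_ge (length t) (monomial Y t)"
  using assms(2)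
proof (induction t)
  case (Cons x t)
  have "order_ge 1 (Y x)" using assms(1)[of x] Cons.prems by (simp add: order_ge_def)
  from order_ge_mult[OF this Cons.IH] show ?case using Cons.prems by simp
qed (simp add: order_ge_def)

lemma coeff_subst_ge:
  assumes "finite V" "\<And>v. v \<in> V \<Longrightarrow> coeff (Y v) [] = 0" and "length u \<le> n"
  shows "coeff (subst V Y f) u = (\<Sum>t\<in>short_lists V n. coeff f t * coeff (monomial Y t) u)"
  unfolding coeff_subst
proof (rule sum.mono_neutral_left)
  show "\<forall>t\<in>short_lists V n - short_lists V (length u). coeff f t * coeff (monomial Y t) u = 0"
    using order_ge_monomial[of V Y, OF assms(2)]
    by (auto simp: short_lists_def order_ge_def) (meson not_le)
qed (use assms in \<open>auto simp: short_lists_def finite_lists_length_le\<close>)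

text \<open>
  Each \<open>Y v\<close> has no constant term, so a monomial of degree \<open>k\<close> goes to a series of order at least
  \<open>k\<close>. Hence every coefficient of a substituted series is a finite sum, and the usual rearrangement
  for polynomials applies.
\<close>

lemma subst_mult:
  fixes Y :: "'a \<Rightarrow> 'a series"
  assumes V: "finite V" and Y: "\<And>v. v \<in> V \<Longrightarrow> coeff (Y v) [] = 0"
  shows "subst V Y (f * g) = subst V Y f * subst V Y g"
proof (rule series_eqI)
  fix u :: "'a list"
  let ?n = "length u" and ?L = "short_lists V (length u)"
  let ?F = "\<lambda>a b. coeff f a * coeff g b * coeff (monomial Y (a @ b)) u"
  have zero: "coeff (monomial Y (a @ b)) u = 0"
    if "set a \<subseteq> V" "set b \<subseteq> V" "\<not> length a + length b \<le> ?n" for a b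
    using order_ge_coeff[OF order_ge_monomial[of V Y "a @ b", OF Y]] that by simp
  have "coeff (subst V Y f * subst V Y g) u = (\<Sum>(p, q)\<in>splits u.
      (\<Sum>a\<in>?L. coeff f a * coeff (monomial Y a) p) * (\<Sum>b\<in>?L. coeff g b * coeff (monomial Y b) q))"
    unfolding coeff_mult
  proof (rule sum.cong[OF HOL.refl], clarify)
    fix p q assume "(p, q) \<in> splits u"
    then have "length p \<le> ?n" "length q \<le> ?n" by auto
    then show "coeff (subst V Y f) p * coeff (subst V Y g) q
      = (\<Sum>a\<in>?L. coeff f a * coeff (monomial Y a) p) * (\<Sum>b\<in>?L. coeff g b * coeff (monomial Y b) q)"
      by (simp add: coeff_subst_ge[OF V Y])
  qed
  also have "\<dots> = (\<Sum>(p, q)\<in>splits u. \<Sum>a\<in>?L. \<Sum>b\<in>?L.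
      coeff f a * coeff g b * (coeff (monomial Y a) p * coeff (monomial Y b) q))"
    by (simp add: sum_product algebra_simps)
  also have "\<dots> = (\<Sum>a\<in>?L. \<Sum>b\<in>?L. \<Sum>(p, q)\<in>splits u.
      coeff f a * coeff g b * (coeff (monomial Y a) p * coeff (monomial Y b) q))"
    unfolding case_prod_beta
    by (subst sum.swap, rule sum.cong[OF HOL.refl], rule sum.swap)
  also have "\<dots> = (\<Sum>a\<in>?L. \<Sum>b\<in>?L. ?F a b)"
    by (simp add: monomial_append coeff_mult sum_distrib_left case_prod_beta)
  also have "\<dots> = (\<Sum>(a, b)\<in>?L \<times> ?L. ?F a b)"
    by (rule sum.cartesian_product)
  also have "\<dots> = (\<Sum>(a, b)\<in>{(a, b). a @ b \<in> ?L}. ?F a b)"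
    using V zero
    by (intro sum.mono_neutral_right) (auto simp: short_lists_def finite_lists_length_le, meson)
  also have "\<dots> = (\<Sum>(t, (a, b))\<in>Sigma ?L splits. ?F a b)"
    by (rule sum.reindex_bij_witness[where i = snd and j = "\<lambda>(a, b). (a @ b, (a, b))"])
      auto
  also have "\<dots> = (\<Sum>t\<in>?L. \<Sum>(a, b)\<in>splits t. ?F a b)"
    using V by (subst sum.Sigma[symmetric]) auto
  also have "\<dots> = coeff (subst V Y (f * g)) u"
    unfolding coeff_subst coeff_mult sum_distrib_right
    by (intro sum.cong HOL.refl) auto
  finally show "coeff (subst V Y (f * g)) u = coeff (subst V Y f * subst V Y g) u" ..
qed

lemma subst_add: "subst V Y (f + g) = subst V Y f + subst V Y g"
  by (rule series_eqI) (simp add: coeff_subst sum.distrib distrib_right)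

lemma subst_diff: "subst V Y (f - g) = subst V Y f - subst V Y g"
  by (rule series_eqI) (simp add: coeff_subst sum_subtractf left_diff_distrib)

lemma subst_one: "finite V \<Longrightarrow> subst V Y 1 = 1"
proof (rule series_eqI)
  fix u assume "finite V"
  have "coeff (subst V Y 1) u = (\<Sum>t\<in>short_lists V (length u). if t = [] then coeff 1 u else 0)"
    unfolding coeff_subst by (rule sum.cong) (auto simp: coeff_one)
  moreover have "[] \<in> short_lists V (length u)" by (simp add: short_lists_def)
  ultimately show "coeff (subst V Y 1) u = coeff 1 u" using \<open>finite V\<close>
    by (simp add: coeff_one)
qed

lemma subst_var:
  assumes V: "finite V" and Y: "\<And>v. v \<in> V \<Longrightarrow> coeff (Y v) [] = 0" and "v \<in> V"
  shows "subst V Y (var v) = Y v"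
proof (rule series_eqI)
  fix u
  have "coeff (subst V Y (var v)) u
      = (\<Sum>t\<in>short_lists V (Suc (length u)). if t = [v] then coeff (Y v) u else 0)"
    by (subst coeff_subst_ge[OF V Y, where n = "Suc (length u)"]) (auto simp: coeff_var intro!: sum.cong)
  moreover have "[v] \<in> short_lists V (Suc (length u))"
    using \<open>v \<in> V\<close> by (simp add: short_lists_def)
  ultimately show "coeff (subst V Y (var v)) u = coeff (Y v) u" using V by simp
qed

text \<open>
  On words, a family \<open>p\<close> lifts the endomorphism of the free group with \<open>x \<mapsto> p x\<close>; no
  reduction is performed.
\<close>

definition word_subst :: "('a \<Rightarrow> 'a word) \<Rightarrow> 'a word \<Rightarrow> 'a word" where
  "word_subst p w = concat (map (\<lambda>(x, b). if b then p x else inv_word (p x)) w)"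

lemma word_subst_Nil [simp]: "word_subst p [] = []"
  and word_subst_Cons [simp]:
    "word_subst p ((x, b) # w) = (if b then p x else inv_word (p x)) @ word_subst p w"
  and word_subst_append [simp]: "word_subst p (u @ v) = word_subst p u @ word_subst p v"
  by (simp_all add: word_subst_def)

lemma word_subst_words_over:
  "(\<And>x. x \<in> V \<Longrightarrow> p x \<in> words_over V) \<Longrightarrow> w \<in> words_over V \<Longrightarrow> word_subst p w \<in> words_over V"
proof (induction w)
  case (Cons l w)
  obtain x b where l: "l = (x, b)" by (cases l)
  have "x \<in> V" "w \<in> words_over V" using Cons.prems by (auto simp: l words_over_def)
  then have "p x \<in> words_over V" "inv_word (p x) \<in> words_over V" "word_subst p w \<in> words_over V"
    using Cons by auto
  then show ?case by (auto simp: l words_over_def)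
qed (simp add: words_over_def)

text \<open>
  An endomorphism of words becomes a continuous endomorphism of the ring of series: both sides are
  multiplicative and agree on the generators, and on their inverses because inverses are unique.
  Through this lemma an automorphism of the group acts on the filtration of the ring.
\<close>

lemma magnus_word_subst:
  assumes V: "finite V" and w: "w \<in> words_over V"
  shows "magnus (word_subst p w) = subst V (\<lambda>v. magnus (p v) - 1) (magnus w)"
  using w
proof (induction w)
  case (Cons l w)
  let ?Y = "\<lambda>v. magnus (p v) - 1"
  have Y: "coeff (?Y v) [] = 0" for v by (simp add: coeff_one)
  obtain x b where l: "l = (x, b)" by (cases l)
  have x: "x \<in> V" and w: "w \<in> words_over V" using Cons.prems by (auto simp: l words_over_def)
  have pos: "subst V ?Y (1 + var x) = magnus (p x)"
    by (simp add: subst_add subst_one[OF V] subst_var[OF V Y x])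
  have "subst V ?Y (var_inv x) * magnus (p x) = subst V ?Y (var_inv x * (1 + var x))"
    unfolding subst_mult[OF V Y] pos ..
  also have "\<dots> = 1" unfolding var_inv_left by (rule subst_one[OF V])
  finally have "subst V ?Y (var_inv x) * (magnus (p x) * magnus (inv_word (p x)))
    = magnus (inv_word (p x))"
    by (simp add: mult.assoc[symmetric])
  then have neg: "subst V ?Y (var_inv x) = magnus (inv_word (p x))"
    by (simp add: magnus_inv_right)
  show ?case using Cons.IH[OF w] pos neg by (simp add: l subst_mult[OF V Y])
qed (simp add: subst_one[OF V])

section \<open>The filtration of partially commuting series\<close>

locale commutation_graph =
  fixes V :: "'a set" and E :: "('a \<times> 'a) set"
  assumes finite_V: "finite V"
    and E_subset: "E \<subseteq> V \<times> V"
    and E_sym: "(x, y) \<in> E \<Longrightarrow> (y, x) \<in> E"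
    and E_irrefl: "(x, x) \<notin> E"
begin

text \<open>
  The ring of interest is the quotient of the series by the relations \<open>v w = w v\<close> for edges
  \<open>(v, w)\<close>. A coefficient of the quotient is the sum of the coefficients over all words that differ
  by swaps of adjacent letters joined by an edge. Instead of forming the quotient, series are tested
  by summing coefficients over sets of words closed under these swaps; such a set is a union of
  equivalence classes. Thus \<open>filt n\<close> consists of the series whose image in the quotient has order
  at least \<open>n\<close>.
\<close>

definition swap_closed :: "'a list set \<Rightarrow> bool" where
  "swap_closed S \<longleftrightarrow> S \<subseteq> lists V \<and>
    (\<forall>s x y t. (x, y) \<in> E \<longrightarrow> s @ x # y # t \<in> S \<longrightarrow> s @ y # x # t \<in> S)"

definition filt :: "nat \<Rightarrow> 'a series set" where
  "filt n = {f. \<forall>S. swap_closed S \<longrightarrow> (\<forall>u\<in>S. length u < n) \<longrightarrow> (\<Sum>u\<in>S. coeff f u) = 0}"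

lemma swap_closedD: "swap_closed S \<Longrightarrow> (x, y) \<in> E \<Longrightarrow> s @ x # y # t \<in> S \<Longrightarrow> s @ y # x # t \<in> S"
  by (auto simp: swap_closed_def)

lemma swap_closed_lists: "swap_closed S \<Longrightarrow> u \<in> S \<Longrightarrow> set u \<subseteq> V"
  by (auto simp: swap_closed_def)

lemma finite_swap_closed:
  assumes "swap_closed S" "\<forall>u\<in>S. length u < n"
  shows "finite S"
proof (rule finite_subset)
  show "S \<subseteq> short_lists V n"
    using assms by (auto simp: short_lists_def swap_closed_def less_imp_le)
qed (simp add: finite_V)

lemma filtD: "f \<in> filt n \<Longrightarrow> swap_closed S \<Longrightarrow> (\<And>u. u \<in> S \<Longrightarrow> length u < n) \<Longrightarrow> (\<Sum>u\<in>S. coeff f u) = 0"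
  by (auto simp: filt_def)

lemma filtI:
  "(\<And>S. swap_closed S \<Longrightarrow> (\<And>u. u \<in> S \<Longrightarrow> length u < n) \<Longrightarrow> finite S \<Longrightarrow> (\<Sum>u\<in>S. coeff f u) = 0)
    \<Longrightarrow> f \<in> filt n"
  using finite_swap_closed by (auto simp: filt_def)

lemma filt_mono: "f \<in> filt n \<Longrightarrow> m \<le> n \<Longrightarrow> f \<in> filt m"
  by (rule filtI) (auto intro!: filtD[of f n] dest: less_le_trans)

lemma filt_0 [simp]: "f \<in> filt 0"
  by (rule filtI) (auto intro: sum.neutral)

lemma filt_1: "f \<in> filt (Suc 0) \<longleftrightarrow> coeff f [] = 0"
proof
  assume "f \<in> filt (Suc 0)"
  from filtD[OF this, of "{[]}"] show "coeff f [] = 0" by (simp add: swap_closed_def)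
next
  assume "coeff f [] = 0"
  then show "f \<in> filt (Suc 0)" by (intro filtI sum.neutral) auto
qed

lemma order_ge_filt: "order_ge n f \<Longrightarrow> f \<in> filt n"
  by (rule filtI, rule sum.neutral) (auto simp: order_ge_def)

lemma filt_zero [simp]: "0 \<in> filt n"
  and filt_add: "f \<in> filt n \<Longrightarrow> g \<in> filt n \<Longrightarrow> f + g \<in> filt n"
  and filt_diff: "f \<in> filt n \<Longrightarrow> g \<in> filt n \<Longrightarrow> f - g \<in> filt n"
  by (auto simp: filt_def sum.distrib sum_subtractf)

lemma filt_uminus: "f \<in> filt n \<Longrightarrow> - f \<in> filt n"
  using filt_diff[of 0 n f] by simp

lemma filt_sum: "(\<And>i. i \<in> I \<Longrightarrow> f i \<in> filt n) \<Longrightarrow> (\<Sum>i\<in>I. f i) \<in> filt n"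
  by (induction I rule: infinite_finite_induct) (auto intro: filt_add)

text \<open>
  The graded pieces of the filtration are torsion-free, since the test sums are integers.
\<close>

lemma filt_torsion_free: "of_int k * f \<in> filt n \<Longrightarrow> k \<noteq> 0 \<Longrightarrow> f \<in> filt n"
  by (simp add: filt_def coeff_of_int_mult sum_distrib_left[symmetric])

text \<open>
  A word in which no two neighbouring letters are joined by an edge is alone in its class, so its
  coefficient is well defined in the quotient. Nonzero elements are recognised on such words.
\<close>

lemma filt_coeff:
  assumes "f \<in> filt n" "length u < n" "set u \<subseteq> V"
    and "\<And>s x y t. u = s @ x # y # t \<Longrightarrow> (x, y) \<notin> E"
  shows "coeff f u = 0"
proof -
  have "swap_closed {u}" using assms(3,4) by (fastforce simp: swap_closed_def)
  from filtD[OF assms(1) this] assms(2) show ?thesis by simp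
qed

lemma sum_fibres:
  assumes "finite P"
  shows "(\<Sum>(a, b)\<in>P. F a b) = (\<Sum>a\<in>fst ` P. \<Sum>b\<in>P `` {a}. F a b)"
proof -
  have P: "P = Sigma (fst ` P) (\<lambda>a. P `` {a})" by force
  have "finite (P `` {a})" for a
    by (rule finite_subset[of _ "snd ` P"]) (use assms in force)+
  then show ?thesis using assms by (subst P, subst sum.Sigma) auto
qed

text \<open>
  If \<open>a @ b\<close> has length less than \<open>m + n\<close>, then \<open>a\<close> is shorter than \<open>m\<close> or \<open>b\<close> is
  shorter than \<open>n\<close>. Fixing the other factor leaves a sum over a swap-closed set, which vanishes. The
  two alternatives overlap; the sum is split according to the length of \<open>a\<close>.
\<close>

lemma filt_mult:
  assumes f: "f \<in> filt m" and g: "g \<in> filt n"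
  shows "f * g \<in> filt (m + n)"
proof (rule filtI)
  fix S assume S: "swap_closed S" and len: "\<And>u. u \<in> S \<Longrightarrow> length u < m + n" and fin: "finite S"
  have sub: "set a \<subseteq> V \<and> set b \<subseteq> V" if "a @ b \<in> S" for a b
    using swap_closed_lists[OF S that] by simp
  define P where "P = {(a, b). a @ b \<in> S}"
  define Q where "Q = {(a, b) \<in> P. length a < m}"
  have "P \<subseteq> (\<Union>u\<in>S. splits u)" by (auto simp: P_def)
  then have finP: "finite P" by (rule finite_subset) (use fin in auto)
  then have finQ: "finite Q" "finite (Q\<inverse>)" by (auto simp: Q_def intro: finite_subset[of _ P])
  have "(\<Sum>u\<in>S. coeff (f * g) u) = (\<Sum>(u, a, b)\<in>Sigma S splits. coeff f a * coeff g b)"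
    unfolding coeff_mult using fin by (subst sum.Sigma) auto
  also have "\<dots> = (\<Sum>(a, b)\<in>P. coeff f a * coeff g b)"
    by (rule sum.reindex_bij_witness[where i = "\<lambda>(a, b). (a @ b, a, b)" and j = snd])
      (auto simp: P_def)
  also have "\<dots> = (\<Sum>(a, b)\<in>Q. coeff f a * coeff g b) + (\<Sum>(a, b)\<in>P - Q. coeff f a * coeff g b)"
    using finP by (subst sum.subset_diff[of Q P]) (auto simp: Q_def)
  also have "(\<Sum>(a, b)\<in>Q. coeff f a * coeff g b) = (\<Sum>(b, a)\<in>Q\<inverse>. coeff f a * coeff g b)"
    by (rule sum.reindex_bij_witness[where i = prod.swap and j = prod.swap]) auto
  also have "\<dots> = (\<Sum>b\<in>fst ` (Q\<inverse>). (\<Sum>a\<in>Q\<inverse> `` {b}. coeff f a) * coeff g b)"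
    using finQ by (simp add: sum_fibres sum_distrib_right)
  also have "\<dots> = 0"
  proof (rule sum.neutral, rule ballI)
    fix b
    have "(\<Sum>a\<in>Q\<inverse> `` {b}. coeff f a) = 0"
    proof (rule filtD[OF f])
      have "(s @ y # x # t) @ b \<in> S" if "(x, y) \<in> E" "(s @ x # y # t) @ b \<in> S" for s x y t
        using swap_closedD[OF S that(1), of s "t @ b"] that(2) by simp
      moreover have "Q\<inverse> `` {b} = {a. a @ b \<in> S \<and> length a < m}" by (auto simp: Q_def P_def)
      ultimately show "swap_closed (Q\<inverse> `` {b})"
        by (auto simp: swap_closed_def dest!: sub)
    qed (auto simp: Q_def)
    then show "(\<Sum>a\<in>Q\<inverse> `` {b}. coeff f a) * coeff g b = 0" by simp
  qed
  also have "(\<Sum>(a, b)\<in>P - Q. coeff f a * coeff g b)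
      = (\<Sum>a\<in>fst ` (P - Q). coeff f a * (\<Sum>b\<in>(P - Q) `` {a}. coeff g b))"
    using finP by (simp add: sum_fibres sum_distrib_left)
  also have "\<dots> = 0"
  proof (rule sum.neutral, rule ballI)
    fix a
    have "(\<Sum>b\<in>(P - Q) `` {a}. coeff g b) = 0"
    proof (rule filtD[OF g])
      have "a @ (s @ y # x # t) \<in> S" if "(x, y) \<in> E" "a @ (s @ x # y # t) \<in> S" for s x y t
        using swap_closedD[OF S that(1), of "a @ s" t] that(2) by simp
      moreover have "(P - Q) `` {a} = {b. a @ b \<in> S \<and> \<not> length a < m}"
        by (auto simp: Q_def P_def)
      ultimately show "swap_closed ((P - Q) `` {a})"
        by (auto simp: swap_closed_def dest!: sub)
      show "length b < n" if "b \<in> (P - Q) `` {a}" for b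
        using that len[of "a @ b"] by (auto simp: P_def Q_def)
    qed
    then show "coeff f a * (\<Sum>b\<in>(P - Q) `` {a}. coeff g b) = 0" by simp
  qed
  finally show "(\<Sum>u\<in>S. coeff (f * g) u) = 0" by simp
qed

lemma filt_mult_left: "g \<in> filt n \<Longrightarrow> f * g \<in> filt n"
  using filt_mult[of f 0 g n] by simp

lemma filt_mult_right: "f \<in> filt n \<Longrightarrow> f * g \<in> filt n"
  using filt_mult[of f n g 0] by simp

text \<open>
  A swap-invariant weight is constant on equivalence classes, and each of its level sets is again
  swap-closed.
\<close>

lemma filt_sum_invariant:
  assumes f: "f \<in> filt n" and T: "swap_closed T" "\<And>t. t \<in> T \<Longrightarrow> length t < n"
    and h: "\<And>s x y t. (x, y) \<in> E \<Longrightarrow> set s \<subseteq> V \<Longrightarrow> set t \<subseteq> V \<Longrightarrow> h (s @ x # y # t) = h (s @ y # x # t)"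
  shows "(\<Sum>t\<in>T. coeff f t * h t) = 0"
proof -
  have fin: "finite T" using finite_swap_closed T by blast
  have "(\<Sum>t\<in>T. coeff f t * h t) = (\<Sum>c\<in>h ` T. \<Sum>t\<in>{t \<in> T. h t = c}. coeff f t * h t)"
    by (rule sum.image_gen[OF fin])
  also have "\<dots> = (\<Sum>c\<in>h ` T. (\<Sum>t\<in>{t \<in> T. h t = c}. coeff f t) * c)"
    by (intro sum.cong HOL.refl) (simp add: sum_distrib_right)
  also have "\<dots> = 0"
  proof (rule sum.neutral, rule ballI)
    fix c
    have "swap_closed {t \<in> T. h t = c}"
      unfolding swap_closed_def
    proof (intro conjI allI impI)
      show "{t \<in> T. h t = c} \<subseteq> lists V" using T(1) by (auto simp: swap_closed_def)
      fix s x y t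
      assume xy: "(x, y) \<in> E" and "s @ x # y # t \<in> {t \<in> T. h t = c}"
      then have st: "s @ x # y # t \<in> T" "h (s @ x # y # t) = c" by auto
      from swap_closed_lists[OF T(1) st(1)] have "set s \<subseteq> V" "set t \<subseteq> V" by auto
      with h[OF xy this] st swap_closedD[OF T(1) xy st(1)]
      show "s @ y # x # t \<in> {t \<in> T. h t = c}" by simp
    qed
    then have "(\<Sum>t\<in>{t \<in> T. h t = c}. coeff f t) = 0" by (rule filtD[OF f]) (use T(2) in auto)
    then show "(\<Sum>t\<in>{t \<in> T. h t = c}. coeff f t) * c = 0" by simp
  qed
  finally show ?thesis .
qed

lemma swap_closed_short: "swap_closed {t. set t \<subseteq> V \<and> length t < n}"
  by (auto simp: swap_closed_def)

definition relators :: "'a word set" where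
  "relators = {[(v, True), (w, True), (v, False), (w, False)] | v w. (v, w) \<in> E}"

lemma var_commute_filt:
  assumes "(v, w) \<in> E"
  shows "var v * var w - var w * var v \<in> filt n"
proof (rule filtI)
  fix S assume S: "swap_closed S" and "finite S"
  have coeff_vw: "coeff (var x * var y) u = (if u = [x, y] then 1 else 0)" for x y :: 'a and u
    by (auto simp: coeff_var_mult coeff_var split: list.split)
  have "[v, w] \<in> S \<longleftrightarrow> [w, v] \<in> S"
    using swap_closedD[OF S assms, of "[]" "[]"] swap_closedD[OF S E_sym[OF assms], of "[]" "[]"]
    by auto
  then show "(\<Sum>u\<in>S. coeff (var v * var w - var w * var v) u) = 0"
    using \<open>finite S\<close> by (simp add: coeff_vw sum_subtractf)
qed

text \<open>
  The Magnus map is well defined on the group, with values in the quotient of the series by the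
  commutation relations.
\<close>

lemma magnus_cong:
  assumes "(u, v) \<in> pres_cong V relators"
  shows "magnus u - magnus v \<in> filt n"
  using assms
proof (induction rule: pres_cong.induct)
  case (cancel x b)
  have "magnus [(x, b), (x, \<not> b)] = 1"
    using magnus_letter_cancel[of x b] by (simp del: magnus_letter.simps)
  then show ?case by simp
next
  case (relator r)
  then obtain v w where r: "r = [(v, True), (w, True), (v, False), (w, False)]" and vw: "(v, w) \<in> E"
    by (auto simp: relators_def)
  have "magnus r - 1 = ((1 + var v) * (1 + var w) - (1 + var w) * (1 + var v)) * (var_inv v * var_inv w)
      + ((1 + var w) * ((1 + var v) * var_inv v) * var_inv w - 1)"
    by (simp add: r left_diff_distrib mult.assoc)
  also have "(1 + var w) * ((1 + var v) * var_inv v) * var_inv w - 1 = 0"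
    by (simp add: var_inv_right)
  also have "(1 + var v) * (1 + var w) - (1 + var w) * (1 + var v) = var v * var w - var w * var v"
    by (simp add: algebra_simps)
  finally show ?case using var_commute_filt[OF vw] by (simp add: filt_mult_right)
next
  case (sym u v)
  then show ?case using filt_uminus by fastforce
next
  case (trans u v w)
  then show ?case using filt_add by fastforce
next
  case (append u u' v v')
  have "magnus (u @ v) - magnus (u' @ v')
    = (magnus u - magnus u') * magnus v + magnus u' * (magnus v - magnus v')"
    by (simp add: algebra_simps)
  then show ?case using append.IH by (simp add: filt_add filt_mult_left filt_mult_right)
qed simp

end

section \<open>Signed graph symmetries\<close>

text \<open>
  A graph symmetry with signs is the degree-one shape of an automorphism in the transvection-free
  case.
\<close>

locale signed_symmetry = commutation_graph V E for V :: "'a set" and E +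
  fixes \<pi> :: "'a \<Rightarrow> 'a" and \<epsilon> :: "'a \<Rightarrow> int"
  assumes perm: "\<pi> permutes V"
    and sign: "\<epsilon> v = 1 \<or> \<epsilon> v = - 1"
    and edge: "(x, y) \<in> E \<Longrightarrow> (\<pi> x, \<pi> y) \<in> E"
begin

abbreviation \<rho> :: "'a \<Rightarrow> 'a" where
  "\<rho> \<equiv> inv_into UNIV \<pi>"

text \<open>
  The ring automorphism \<open>v \<mapsto> \<epsilon> v \<cdot> \<pi> v\<close>, written as an operation on coefficients.
\<close>

definition act :: "'a series \<Rightarrow> 'a series" where
  "act f = series (\<lambda>u. prod_list (map (\<epsilon> \<circ> \<rho>) u) * coeff f (map (\<rho>) u))"

lemma coeff_act: "coeff (act f) u = prod_list (map (\<epsilon> \<circ> \<rho>) u) * coeff f (map (\<rho>) u)"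
  by (simp add: act_def)

lemma inv_pi [simp]: "\<rho> (\<pi> x) = x" "\<pi> (\<rho> x) = x"
  using perm by (simp_all add: permutes_inverses)

lemma inv_pi_comp [simp]: "\<rho> \<circ> \<pi> = id" "\<pi> \<circ> \<rho> = id"
  by (auto simp: fun_eq_iff)

lemma pi_V: "\<pi> x \<in> V \<longleftrightarrow> x \<in> V"
  using perm by (rule permutes_in_image)

text \<open>
  Reindexing along \<open>\<pi>\<close> moves the action from the series to the test set, whose preimage is
  again swap-closed because \<open>\<pi>\<close> preserves edges.
\<close>

lemma coeff_act_sum:
  "(\<Sum>u\<in>S. coeff (act f) u) = (\<Sum>t | map \<pi> t \<in> S. coeff f t * prod_list (map \<epsilon> t))"
  by (rule sum.reindex_bij_witness[where i = "map \<pi>" and j = "map (\<rho>)"])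
    (auto simp: coeff_act mult.commute)

lemma swap_closed_vimage:
  assumes "swap_closed S"
  shows "swap_closed {t. map \<pi> t \<in> S}"
proof -
  have "set t \<subseteq> V" if "map \<pi> t \<in> S" for t
    using swap_closed_lists[OF assms that] by (auto simp: pi_V)
  moreover have "map \<pi> (s @ y # x # t) \<in> S" if "(x, y) \<in> E" "map \<pi> (s @ x # y # t) \<in> S" for s x y t
    using swap_closedD[OF assms edge[OF that(1)], of "map \<pi> s" "map \<pi> t"] that(2) by simp
  ultimately show ?thesis unfolding swap_closed_def by blast
qed

lemma act_filt:
  assumes "f \<in> filt n"
  shows "act f \<in> filt n"
proof (rule filtI)
  fix S assume S: "swap_closed S" "\<And>u. u \<in> S \<Longrightarrow> length u < n"
  show "(\<Sum>u\<in>S. coeff (act f) u) = 0"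
    unfolding coeff_act_sum
  proof (rule filt_sum_invariant[OF assms swap_closed_vimage[OF S(1)]])
    show "length t < n" if "t \<in> {t. map \<pi> t \<in> S}" for t using S(2)[of "map \<pi> t"] that by simp
  qed (simp add: mult.left_commute)
qed

lemma act_add: "act (f + g) = act f + act g"
  and act_diff: "act (f - g) = act f - act g"
  by (rule series_eqI; simp add: coeff_act algebra_simps)+

lemma act_of_int: "act (of_int k * f) = of_int k * act f"
  by (rule series_eqI) (simp add: coeff_act coeff_of_int_mult)

text \<open>
  The sign of a word is a product of signs of its letters, so a letter that occurs an even number of
  times contributes no sign.
\<close>

lemma coeff_act_power:
  "\<exists>s. (\<forall>x. s x = 1 \<or> s x = - 1) \<and>
    (\<forall>f u. coeff ((act ^^ k) f) u = prod_list (map s u) * coeff f (map (\<rho> ^^ k) u))"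
proof (induction k)
  case 0
  have "prod_list (map (\<lambda>_. 1 :: int) u) = 1" for u :: "'a list" by (induction u) auto
  then show ?case by (intro exI[of _ "\<lambda>_. 1"]) (simp add: map_idI)
next
  case (Suc k)
  then obtain s where s: "\<And>x. s x = 1 \<or> s x = - 1"
    "\<And>f u. coeff ((act ^^ k) f) u = prod_list (map s u) * coeff f (map (\<rho> ^^ k) u)" by blast
  let ?s = "\<lambda>x. \<epsilon> (\<rho> x) * s (\<rho> x)"
  have prod: "prod_list (map ?s u)
    = prod_list (map (\<epsilon> \<circ> \<rho>) u) * prod_list (map s (map (\<rho>) u))" for u
    by (induction u) auto
  have "coeff ((act ^^ Suc k) f) u = prod_list (map ?s u) * coeff f (map (\<rho> ^^ Suc k) u)" for f u
  proof -
    have "coeff ((act ^^ Suc k) f) u = coeff (act ((act ^^ k) f)) u" by simp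
    also have "\<dots> = prod_list (map ?s u) * coeff f (map (\<rho> ^^ k) (map \<rho> u))"
      unfolding coeff_act s(2) prod by (rule mult.assoc[symmetric])
    also have "map (\<rho> ^^ k) (map \<rho> u) = map (\<rho> ^^ Suc k) u"
      by (simp add: funpow_Suc_right del: funpow.simps)
    finally show ?thesis .
  qed
  moreover have "?s x = 1 \<or> ?s x = - 1" for x using s(1)[of "\<rho> x"] sign[of "\<rho> x"] by auto
  ultimately show ?case by (intro exI[of _ ?s] conjI allI)
qed

text \<open>
  Once \<open>\<pi>\<close> has been iterated to the identity only signs remain, and a second round removes these.
\<close>

lemma act_finite_order: "\<exists>N>0. \<forall>f. (act ^^ N) f = f"
proof -
  have "permutation (\<rho>)"
    using permutes_inv[OF perm] finite_V permutation_permutes by blast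
  then obtain m where m: "(\<rho> ^^ m) = id" "m > 0" by (rule permutation_is_nilpotent)
  obtain s where s: "\<And>x. s x = 1 \<or> s x = (- 1 :: int)"
    "\<And>f u. coeff ((act ^^ m) f) u = prod_list (map s u) * coeff f u"
    using coeff_act_power[of m] by (auto simp: m(1))
  have sq: "prod_list (map s u) * prod_list (map s u) = 1" for u
  proof (induction u)
    case (Cons x u)
    then show ?case using s(1)[of x] by auto
  qed simp
  have "(act ^^ (m + m)) f = f" for f
  proof (rule series_eqI)
    fix u
    have "coeff ((act ^^ (m + m)) f) u
      = (prod_list (map s u) * prod_list (map s u)) * coeff f u"
      unfolding funpow_add comp_def s(2) by (simp only: mult.assoc)
    then show "coeff ((act ^^ (m + m)) f) u = coeff f u" by (simp add: sq)
  qed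
  then show ?thesis using m(2) by (intro exI[of _ "m + m"]) auto
qed

lemma monomial_leading:
  assumes Y: "\<And>v. v \<in> V \<Longrightarrow> coeff (Y v) [] = 0"
    and lin: "\<And>a v. a \<in> V \<Longrightarrow> v \<in> V \<Longrightarrow> coeff (Y v) [a] = (if a = \<pi> v then \<epsilon> v else 0)"
  shows "set t \<subseteq> V \<Longrightarrow> set u \<subseteq> V \<Longrightarrow> length u = length t \<Longrightarrow>
    coeff (monomial Y t) u = (if u = map \<pi> t then prod_list (map \<epsilon> t) else 0)"
proof (induction t arbitrary: u)
  case Nil
  then show ?case by (simp add: coeff_one)
next
  case (Cons x t)
  then obtain a u' where u: "u = a # u'" by (cases u) auto
  have x: "order_ge 1 (Y x)" using Cons.prems Y by (simp add: order_ge_def)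
  have t: "order_ge (length t) (monomial Y t)" using Cons.prems by (intro order_ge_monomial[of V] Y) auto
  have "coeff (monomial Y (x # t)) u = coeff (Y x) [a] * coeff (monomial Y t) u'"
    using coeff_mult_leading[OF x t, of u] Cons.prems by (simp add: u)
  then show ?case using Cons by (simp add: u lin)
qed

text \<open>
  An endomorphism acts on each graded piece through its linear part only. For the words \<open>t\<close> shorter
  than \<open>n\<close>, the sum of the coefficients of \<open>monomial Y t\<close> over a swap-closed set is a
  swap-invariant function of \<open>t\<close>, because the \<open>Y x\<close> commute along edges; so these words contribute
  nothing to a series in \<open>filt n\<close>. For words of length \<open>n\<close> only the linear terms of the factors
  reach degree \<open>n\<close>.
\<close>

lemma subst_leading:
  assumes Y: "\<And>v. v \<in> V \<Longrightarrow> coeff (Y v) [] = 0"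
    and lin: "\<And>a v. a \<in> V \<Longrightarrow> v \<in> V \<Longrightarrow> coeff (Y v) [a] = (if a = \<pi> v then \<epsilon> v else 0)"
    and comm: "\<And>x y n. (x, y) \<in> E \<Longrightarrow> Y x * Y y - Y y * Y x \<in> filt n"
    and f: "f \<in> filt n"
  shows "subst V Y f - act f \<in> filt (Suc n)"
proof (rule filtI)
  fix S assume S: "swap_closed S" "\<And>u. u \<in> S \<Longrightarrow> length u < Suc n" "finite S"
  define S1 where "S1 = {u \<in> S. length u = n}"
  define S0 where "S0 = {u \<in> S. length u < n}"
  define h where "h t = (\<Sum>u\<in>S. coeff (monomial Y t) u)" for t
  define T where "T = {t. set t \<subseteq> V \<and> length t < n}"
  define T' where "T' = {t. set t \<subseteq> V \<and> length t = n}"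
  have "T \<subseteq> short_lists V n" "T' \<subseteq> short_lists V n" by (auto simp: T_def T'_def short_lists_def)
  then have finT: "finite T" "finite T'"
    using finite_V by (meson finite_subset finite_short_lists)+
  have short: "short_lists V n = T \<union> T'" "T \<inter> T' = {}"
    by (auto simp: short_lists_def T_def T'_def)
  have "h (s @ x # y # t) = h (s @ y # x # t)" if "(x, y) \<in> E" for s x y t
  proof -
    have "monomial Y (s @ x # y # t) - monomial Y (s @ y # x # t)
      = monomial Y s * (Y x * Y y - Y y * Y x) * monomial Y t"
      by (simp add: monomial_append algebra_simps)
    also have "\<dots> \<in> filt (Suc n)" by (intro filt_mult_left filt_mult_right comm that)
    finally have "(\<Sum>u\<in>S. coeff (monomial Y (s @ x # y # t) - monomial Y (s @ y # x # t)) u) = 0"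
      by (rule filtD) (use S in auto)
    then show ?thesis by (simp add: h_def sum_subtractf)
  qed
  then have T0: "(\<Sum>t\<in>T. coeff f t * h t) = 0"
    by (intro filt_sum_invariant[OF f]) (auto simp: T_def swap_closed_short)
  have h_T': "h t = (if map \<pi> t \<in> S1 then prod_list (map \<epsilon> t) else 0)" if t: "t \<in> T'" for t
  proof -
    have "h t = (\<Sum>u\<in>S. if u = map \<pi> t then prod_list (map \<epsilon> t) else 0)"
      unfolding h_def
    proof (rule sum.cong[OF HOL.refl])
      fix u assume u: "u \<in> S"
      show "coeff (monomial Y t) u = (if u = map \<pi> t then prod_list (map \<epsilon> t) else 0)"
      proof (cases "length u = n")
        case True
        then show ?thesis using t swap_closed_lists[OF S(1) u]
          by (intro monomial_leading Y lin) (auto simp: T'_def)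
      next
        case False
        then have "length u < length t" using S(2)[OF u] t by (auto simp: T'_def)
        then show ?thesis
          using order_ge_coeff[OF order_ge_monomial[of V Y t, OF Y]] t by (auto simp: T'_def)
      qed
    qed
    then show ?thesis using \<open>finite S\<close> t by (auto simp: S1_def T'_def)
  qed
  have "(\<Sum>u\<in>S. coeff (subst V Y f) u)
    = (\<Sum>u\<in>S. \<Sum>t\<in>short_lists V n. coeff f t * coeff (monomial Y t) u)"
    using S(2) by (intro sum.cong HOL.refl coeff_subst_ge finite_V Y) (auto simp: less_Suc_eq_le)
  also have "\<dots> = (\<Sum>t\<in>short_lists V n. coeff f t * h t)"
    unfolding h_def sum_distrib_left by (rule sum.swap)
  also have "\<dots> = (\<Sum>t\<in>T'. coeff f t * h t)"
    unfolding short using finT short(2) T0 by (simp add: sum.union_disjoint)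
  also have "\<dots> = (\<Sum>t\<in>T'. if map \<pi> t \<in> S1 then coeff f t * prod_list (map \<epsilon> t) else 0)"
    by (intro sum.cong) (auto simp: h_T')
  also have "\<dots> = (\<Sum>t | map \<pi> t \<in> S1. coeff f t * prod_list (map \<epsilon> t))"
  proof -
    have "t \<in> T'" if "map \<pi> t \<in> S1" for t
      using swap_closed_lists[OF S(1), of "map \<pi> t"] that by (auto simp: S1_def T'_def pi_V)
    then have "{t. map \<pi> t \<in> S1} \<subseteq> T'" by auto
    then show ?thesis
      using finT by (simp add: sum.inter_filter[symmetric] Int_absorb1 Collect_conj_eq)
  qed
  also have "\<dots> = (\<Sum>u\<in>S1. coeff (act f) u)" by (rule coeff_act_sum[symmetric])
  also have "\<dots> = (\<Sum>u\<in>S. coeff (act f) u)"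
  proof -
    have "swap_closed S0" using S(1) by (auto simp: swap_closed_def S0_def)
    then have "(\<Sum>u\<in>S0. coeff (act f) u) = 0"
      by (rule filtD[OF act_filt[OF f]]) (auto simp: S0_def)
    moreover have "length u < n \<or> length u = n" if "u \<in> S" for u using S(2)[OF that] by auto
    then have "S = S0 \<union> S1" "S0 \<inter> S1 = {}" by (auto simp: S0_def S1_def)
    ultimately show ?thesis using S(3) by (simp add: sum.union_disjoint)
  qed
  finally show "(\<Sum>u\<in>S. coeff (subst V Y f - act f) u) = 0" by (simp add: sum_subtractf)
qed

end

section \<open>A commutator word that no signed symmetry can negate\<close>

definition comm_word :: "'a word \<Rightarrow> 'a word \<Rightarrow> 'a word" where
  "comm_word a b = a @ b @ inv_word a @ inv_word b"

lemma comm_word_words_over: "a \<in> words_over V \<Longrightarrow> b \<in> words_over V \<Longrightarrow> comm_word a b \<in> words_over V"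
  using inv_word_words_over[of a V] inv_word_words_over[of b V]
  by (auto simp: comm_word_def words_over_def)

text \<open>
  Group commutators add the multidegrees of leading parts. The component of degree \<open>size m\<close> may be
  zero, so that nonvanishing is a separate question.
\<close>

definition leading_degree :: "'a multiset \<Rightarrow> 'a word \<Rightarrow> bool" where
  "leading_degree m w \<longleftrightarrow> order_ge (size m) (magnus w - 1) \<and>
    (\<forall>u. length u = size m \<longrightarrow> coeff (magnus w - 1) u \<noteq> 0 \<longrightarrow> mset u = m)"

lemma leading_degree_letter: "leading_degree {#v#} [(v, True)]"
  by (auto simp: leading_degree_def order_ge_def coeff_var)

text \<open>
  With \<open>\<alpha> = magnus a - 1\<close> and \<open>\<beta> = magnus b - 1\<close>, the Magnus image of the commutator minus one is
  \<open>(\<alpha> * \<beta> - \<beta> * \<alpha>) * C\<close>, where \<open>C\<close> has constant term one. So the leading part of a group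
  commutator is the ring commutator of the leading parts.
\<close>

lemma
  assumes a: "leading_degree m a" and b: "leading_degree n b"
  shows leading_degree_comm: "leading_degree (m + n) (comm_word a b)"
    and coeff_comm_leading: "length u = size m + size n \<Longrightarrow>
      coeff (magnus (comm_word a b) - 1) u
      = coeff (magnus a - 1) (take (size m) u) * coeff (magnus b - 1) (drop (size m) u)
      - coeff (magnus b - 1) (take (size n) u) * coeff (magnus a - 1) (drop (size n) u)"
proof -
  let ?\<alpha> = "magnus a - 1" and ?\<beta> = "magnus b - 1"
  let ?D = "?\<alpha> * ?\<beta> - ?\<beta> * ?\<alpha>" and ?C = "magnus (inv_word a @ inv_word b)"
  have oa: "order_ge (size m) ?\<alpha>" and ob: "order_ge (size n) ?\<beta>"
    using a b by (auto simp: leading_degree_def)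
  have "magnus b * magnus a * (magnus (inv_word a) * magnus (inv_word b))
    = magnus b * (magnus a * magnus (inv_word a)) * magnus (inv_word b)"
    by (simp only: mult.assoc)
  then have "magnus b * magnus a * ?C = 1" by (simp add: magnus_inv_right)
  then have "magnus (comm_word a b) - 1 = (magnus a * magnus b - magnus b * magnus a) * ?C"
    by (simp add: comm_word_def left_diff_distrib mult.assoc)
  also have "magnus a * magnus b - magnus b * magnus a = ?D" by (simp add: algebra_simps)
  finally have eq: "magnus (comm_word a b) - 1 = ?D * ?C" .
  have D: "order_ge (size m + size n) ?D"
    using order_ge_mult[OF oa ob] order_ge_mult[OF ob oa] by (simp add: order_ge_def add.commute)
  have C: "order_ge 0 ?C" by (simp add: order_ge_def)
  have ord: "order_ge (size m + size n) (magnus (comm_word a b) - 1)"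
    unfolding eq using order_ge_mult[OF D C] by simp
  have lead: "coeff (magnus (comm_word a b) - 1) u
      = coeff ?\<alpha> (take (size m) u) * coeff ?\<beta> (drop (size m) u)
      - coeff ?\<beta> (take (size n) u) * coeff ?\<alpha> (drop (size n) u)"
    if u: "length u = size m + size n" for u
  proof -
    have "coeff (?D * ?C) u = coeff ?D u"
      using coeff_mult_leading[OF D C, of u] u by simp
    moreover have "coeff (?\<alpha> * ?\<beta>) u = coeff ?\<alpha> (take (size m) u) * coeff ?\<beta> (drop (size m) u)"
      by (rule coeff_mult_leading[OF oa ob u])
    moreover have "coeff (?\<beta> * ?\<alpha>) u = coeff ?\<beta> (take (size n) u) * coeff ?\<alpha> (drop (size n) u)"
      by (rule coeff_mult_leading[OF ob oa]) (simp add: u)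
    ultimately show ?thesis by (simp only: eq coeff_diff)
  qed
  then show "length u = size m + size n \<Longrightarrow>
      coeff (magnus (comm_word a b) - 1) u
      = coeff ?\<alpha> (take (size m) u) * coeff ?\<beta> (drop (size m) u)
      - coeff ?\<beta> (take (size n) u) * coeff ?\<alpha> (drop (size n) u)" .
  have "mset u = m + n"
    if u: "length u = size m + size n" and nz: "coeff (magnus (comm_word a b) - 1) u \<noteq> 0" for u
  proof -
    have da: "coeff ?\<alpha> x \<noteq> 0 \<Longrightarrow> length x = size m \<Longrightarrow> mset x = m"
      and db: "coeff ?\<beta> x \<noteq> 0 \<Longrightarrow> length x = size n \<Longrightarrow> mset x = n" for x
      using a b by (auto simp: leading_degree_def)
    from nz consider
        "coeff ?\<alpha> (take (size m) u) \<noteq> 0" "coeff ?\<beta> (drop (size m) u) \<noteq> 0"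
      | "coeff ?\<beta> (take (size n) u) \<noteq> 0" "coeff ?\<alpha> (drop (size n) u) \<noteq> 0"
      unfolding lead[OF u] by fastforce
    then show ?thesis
    proof cases
      case 1
      have "mset u = mset (take (size m) u) + mset (drop (size m) u)"
        by (metis append_take_drop_id mset_append)
      then show ?thesis using da[OF 1(1)] db[OF 1(2)] u by simp
    next
      case 2
      have "mset u = mset (take (size n) u) + mset (drop (size n) u)"
        by (metis append_take_drop_id mset_append)
      then show ?thesis using db[OF 2(1)] da[OF 2(2)] u by (simp add: add.commute)
    qed
  qed
  then show "leading_degree (m + n) (comm_word a b)" using ord by (simp add: leading_degree_def)
qed

text \<open>
  The commutator \<open>[[v, w], [w, [w, [w, v]]]]\<close>. Its multidegree is two in \<open>v\<close> and four in \<open>w\<close>.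
  Both exponents are even, so signs of the variables cancel; they are distinct, so a permutation of
  the variables that preserves the multidegree fixes \<open>v\<close> and \<open>w\<close>.
\<close>

definition test_word :: "'a \<Rightarrow> 'a \<Rightarrow> 'a word" where
  "test_word v w = (let x = [(v, True)]; y = [(w, True)] in
    comm_word (comm_word x y) (comm_word y (comm_word y (comm_word y x))))"

lemma test_word_words_over: "v \<in> V \<Longrightarrow> w \<in> V \<Longrightarrow> test_word v w \<in> words_over V"
  unfolding test_word_def Let_def by (intro comm_word_words_over) (auto simp: words_over_def)

text \<open>
  The leading parts of the two factors are \<open>vw - wv\<close> and \<open>wwwv - 3 wwvw + 3 wvww - vwww\<close>. In
  their ring commutator, only the product of \<open>vw\<close> and \<open>3 wvww\<close> contributes to the word
  \<open>vwwvww\<close>, so the leading part does not vanish.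
\<close>

lemma
  fixes v w :: 'a
  assumes "v \<noteq> w"
  shows leading_degree_test_word: "leading_degree {#v, v, w, w, w, w#} (test_word v w)"
    and coeff_test_word: "coeff (magnus (test_word v w) - 1) [v, w, w, v, w, w] = 3"
proof -
  define x where "x = [(v, True)]"
  define y where "y = [(w, True)]"
  have x: "leading_degree {#v#} x" and y: "leading_degree {#w#} y"
    by (auto simp: x_def y_def leading_degree_letter)
  note a2 = leading_degree_comm[OF x y] and b2 = leading_degree_comm[OF y x]
  note b3 = leading_degree_comm[OF y b2]
  note b4 = leading_degree_comm[OF y b3]
  have t: "test_word v w = comm_word (comm_word x y) (comm_word y (comm_word y (comm_word y x)))"
    by (simp add: test_word_def x_def y_def Let_def)
  have deg: "{#v#} + {#w#} + ({#w#} + ({#w#} + ({#w#} + {#v#}))) = {#v, v, w, w, w, w#}"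
    by (simp add: add_mset_commute)
  show "leading_degree {#v, v, w, w, w, w#} (test_word v w)"
    using leading_degree_comm[OF a2 b4] unfolding t deg .
  have cx: "coeff (magnus x - 1) [z] = (if z = v then 1 else 0)" for z
    by (simp add: x_def coeff_var)
  have cy: "coeff (magnus y - 1) [z] = (if z = w then 1 else 0)" for z
    by (simp add: y_def coeff_var)
  note c2 = coeff_comm_leading[OF x y] coeff_comm_leading[OF y x]
    and c3 = coeff_comm_leading[OF y b2] and c4 = coeff_comm_leading[OF y b3]
  have "coeff (magnus (test_word v w) - 1) [v, w, w, v, w, w]
    = coeff (magnus (comm_word x y) - 1) [v, w]
        * coeff (magnus (comm_word y (comm_word y (comm_word y x))) - 1) [w, v, w, w]
    - coeff (magnus (comm_word y (comm_word y (comm_word y x))) - 1) [v, w, w, v]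
        * coeff (magnus (comm_word x y) - 1) [w, w]"
    unfolding t by (subst coeff_comm_leading[OF a2 b4]) (simp_all del: coeff_diff)
  also have "\<dots> = 3"
    using assms by (simp add: c2 c3 c4 cx cy del: coeff_diff)
  finally show "coeff (magnus (test_word v w) - 1) [v, w, w, v, w, w] = 3" .
qed

section \<open>Transvection-free graphs force signed permutations\<close>

context commutation_graph
begin

text \<open>
  The matrices are the actions of an automorphism and of its inverse on degree one. Two linear forms
  \<open>x\<close> and \<open>y\<close> commute in degree two iff \<open>x a * y b = x b * y a\<close> for all non-adjacent \<open>a\<close> and
  \<open>b\<close>, so the assumptions say that both matrices send adjacent vertices to commuting forms.

  Suppose that \<open>a\<close> occurs in the image of \<open>v\<close>. If \<open>u\<close> is a neighbour of \<open>v\<close>, the images of \<open>u\<close> and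
  \<open>v\<close> commute, and eliminating \<open>a\<close> from them leaves a form \<open>r\<close> supported on neighbours of \<open>a\<close>.
  Hence the preimage of \<open>r\<close>, a combination of \<open>u\<close> and \<open>v\<close> in which \<open>u\<close> has the coefficient
  \<open>M a v\<close>, commutes with the preimage of \<open>a\<close>. If \<open>u\<close> is moreover not in the star of \<open>w\<close>, comparing
  coefficients at \<open>u\<close> and \<open>w\<close> shows that \<open>w\<close> does not occur in the preimage of \<open>a\<close>.
\<close>

lemma inverse_pair_monomial:
  fixes M M' :: "'a \<Rightarrow> 'a \<Rightarrow> int"
  assumes free: "\<And>v w. v \<in> V \<Longrightarrow> w \<in> V \<Longrightarrow> v \<noteq> w \<Longrightarrow> \<exists>u. (v, u) \<in> E \<and> u \<noteq> w \<and> (w, u) \<notin> E"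
    and M'M: "\<And>a v. a \<in> V \<Longrightarrow> v \<in> V \<Longrightarrow> (\<Sum>t\<in>V. M' a t * M t v) = (if a = v then 1 else 0)"
    and M: "\<And>u v a b. (u, v) \<in> E \<Longrightarrow> a \<in> V \<Longrightarrow> b \<in> V \<Longrightarrow> (a, b) \<notin> E \<Longrightarrow> M a u * M b v = M b u * M a v"
    and M': "\<And>u v a b. (u, v) \<in> E \<Longrightarrow> a \<in> V \<Longrightarrow> b \<in> V \<Longrightarrow> (a, b) \<notin> E \<Longrightarrow> M' a u * M' b v = M' b u * M' a v"
    and "a \<in> V" "v \<in> V" "w \<in> V" "w \<noteq> v" "M a v \<noteq> 0"
  shows "M' w a = 0"
proof -
  obtain u where u: "(v, u) \<in> E" "u \<noteq> w" "(w, u) \<notin> E" using free[OF \<open>v \<in> V\<close> \<open>w \<in> V\<close>] \<open>w \<noteq> v\<close> by blast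
  have uV: "u \<in> V" and uv: "u \<noteq> v" using u E_subset E_irrefl by auto
  define r where "r b = M a v * M b u - M a u * M b v" for b
  have r0: "r b = 0" if "b \<in> V" "(b, a) \<notin> E" for b
  proof -
    have "(a, b) \<notin> E" using that(2) E_sym by blast
    from M[OF u(1) \<open>a \<in> V\<close> that(1) this] show ?thesis by (simp add: r_def algebra_simps)
  qed
  have M'r: "(\<Sum>b\<in>V. M' c b * r b) = M a v * (if c = u then 1 else 0) - M a u * (if c = v then 1 else 0)"
    if "c \<in> V" for c
  proof -
    have "(\<Sum>b\<in>V. M' c b * r b) = M a v * (\<Sum>b\<in>V. M' c b * M b u) - M a u * (\<Sum>b\<in>V. M' c b * M b v)"
      by (simp add: r_def sum_distrib_left sum_subtractf algebra_simps)
    then show ?thesis using that uV \<open>v \<in> V\<close> by (simp add: M'M)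
  qed
  have "(u, w) \<notin> E" using u(3) E_sym by blast
  then have swap: "M' u b * r b * M' w a = M' w b * r b * M' u a" if "b \<in> V" for b
    using M'[of b a u w] r0[OF that] uV \<open>w \<in> V\<close> by (cases "(b, a) \<in> E") (auto simp: algebra_simps)
  have "(\<Sum>b\<in>V. M' u b * r b) * M' w a = (\<Sum>b\<in>V. M' w b * r b) * M' u a"
    unfolding sum_distrib_right by (intro sum.cong HOL.refl swap)
  then have "M a v * M' w a = 0" using uv u(2) \<open>w \<noteq> v\<close> uV \<open>w \<in> V\<close> by (simp add: M'r)
  then show ?thesis using \<open>M a v \<noteq> 0\<close> by simp
qed

text \<open>
  By the preceding lemma, the column of \<open>M'\<close> at \<open>a\<close> is supported at \<open>v\<close> alone as soon as
  \<open>M a v\<close> is nonzero. Then the product of the two matrices shows that the column of \<open>M\<close> at \<open>v\<close> is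
  supported at \<open>a\<close> alone, with an entry that is invertible in the integers.
\<close>

lemma inverse_pair_signed_permutation:
  fixes M M' :: "'a \<Rightarrow> 'a \<Rightarrow> int"
  assumes free: "\<And>v w. v \<in> V \<Longrightarrow> w \<in> V \<Longrightarrow> v \<noteq> w \<Longrightarrow> \<exists>u. (v, u) \<in> E \<and> u \<noteq> w \<and> (w, u) \<notin> E"
    and MM': "\<And>a v. a \<in> V \<Longrightarrow> v \<in> V \<Longrightarrow> (\<Sum>t\<in>V. M a t * M' t v) = (if a = v then 1 else 0)"
    and M'M: "\<And>a v. a \<in> V \<Longrightarrow> v \<in> V \<Longrightarrow> (\<Sum>t\<in>V. M' a t * M t v) = (if a = v then 1 else 0)"
    and M: "\<And>u v a b. (u, v) \<in> E \<Longrightarrow> a \<in> V \<Longrightarrow> b \<in> V \<Longrightarrow> (a, b) \<notin> E \<Longrightarrow> M a u * M b v = M b u * M a v"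
    and M': "\<And>u v a b. (u, v) \<in> E \<Longrightarrow> a \<in> V \<Longrightarrow> b \<in> V \<Longrightarrow> (a, b) \<notin> E \<Longrightarrow> M' a u * M' b v = M' b u * M' a v"
  obtains \<pi> \<epsilon> where "signed_symmetry V E \<pi> \<epsilon>"
    "\<And>a v. a \<in> V \<Longrightarrow> v \<in> V \<Longrightarrow> M a v = (if a = \<pi> v then \<epsilon> v else 0)"
proof -
  have ex: "\<exists>a\<in>V. M a v \<noteq> 0" if "v \<in> V" for v
  proof (rule ccontr)
    assume "\<not> ?thesis"
    then show False using M'M[OF that that] by simp
  qed
  have col: "M b v * M' v a = (if b = a then 1 else 0)"
    if "a \<in> V" "v \<in> V" "M a v \<noteq> 0" "b \<in> V" for a b v
  proof -
    have "(\<Sum>t\<in>V. M b t * M' t a) = (\<Sum>t\<in>V. if t = v then M b v * M' v a else 0)"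
      using inverse_pair_monomial[of M' M a v, OF free M'M M M' that(1,2)] that
      by (intro sum.cong) auto
    then show ?thesis using MM'[OF that(4,1)] that(2) finite_V by simp
  qed
  define \<pi> where "\<pi> v = (if v \<in> V then SOME a. a \<in> V \<and> M a v \<noteq> 0 else v)" for v
  define \<epsilon> where "\<epsilon> v = (if v \<in> V then M (\<pi> v) v else 1)" for v
  have pi: "\<pi> v \<in> V" "M (\<pi> v) v \<noteq> 0" if "v \<in> V" for v
    using someI_ex[of "\<lambda>a. a \<in> V \<and> M a v \<noteq> 0"] ex[OF that] that by (auto simp: \<pi>_def)
  have one: "M (\<pi> v) v * M' v (\<pi> v) = 1" if "v \<in> V" for v
    using col[OF pi(1)[OF that] that pi(2)[OF that] pi(1)[OF that]] by simp
  have sgn: "\<epsilon> v = 1 \<or> \<epsilon> v = - 1" for v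
    using one[of v] zmult_eq_1_iff by (auto simp: \<epsilon>_def)
  have lin: "M a v = (if a = \<pi> v then \<epsilon> v else 0)" if "a \<in> V" "v \<in> V" for a v
  proof (cases "a = \<pi> v")
    case False
    then have "M a v * M' v (\<pi> v) = 0" using col[OF pi(1)[OF that(2)] that(2) pi(2)[OF that(2)] that(1)] by simp
    moreover have "M' v (\<pi> v) \<noteq> 0" using one[OF that(2)] by auto
    ultimately show ?thesis using False by simp
  qed (use that in \<open>simp add: \<epsilon>_def\<close>)
  have inj: "inj_on \<pi> V"
  proof (rule inj_onI, rule ccontr)
    fix v w assume vw: "v \<in> V" "w \<in> V" "\<pi> v = \<pi> w" "v \<noteq> w"
    have "M' w (\<pi> v) = 0"
      by (rule inverse_pair_monomial[of M' M "\<pi> v" v w, OF free M'M M M'])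
        (use vw(1,2,4) pi[OF vw(1)] in simp_all)
    then show False using one[OF vw(2)] vw(3) by simp
  qed
  have perm: "\<pi> permutes V"
  proof (rule bij_imp_permutes)
    have "\<pi> ` V = V" by (rule endo_inj_surj[OF finite_V _ inj]) (auto simp: pi)
    then show "bij_betw \<pi> V V" using inj by (simp add: bij_betw_def)
  qed (simp add: \<pi>_def)
  have edge: "(\<pi> x, \<pi> y) \<in> E" if "(x, y) \<in> E" for x y
  proof (rule ccontr)
    assume ne: "(\<pi> x, \<pi> y) \<notin> E"
    have xy: "x \<in> V" "y \<in> V" "x \<noteq> y" using that E_subset E_irrefl by auto
    then have "\<pi> x \<noteq> \<pi> y" using inj by (auto dest: inj_onD)
    then have "M (\<pi> y) x = 0" using lin[of "\<pi> y" x] xy pi by simp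
    then have "M (\<pi> x) x * M (\<pi> y) y = 0"
      using M[OF that pi(1) pi(1) ne] xy by simp
    then show False using pi xy by simp
  qed
  have "signed_symmetry V E \<pi> \<epsilon>" by unfold_locales (fact perm sgn edge)+
  then show thesis using lin by (rule that)
qed

end

section \<open>Twisted conjugacy of powers\<close>

context signed_symmetry
begin

text \<open>
  The sum over an orbit of \<open>act\<close>, used with \<open>act ^^ N = id\<close>. It kills everything of the form
  \<open>act f - f\<close>, and it multiplies fixed elements by \<open>N\<close>.
\<close>

definition norm :: "nat \<Rightarrow> 'a series \<Rightarrow> 'a series" where
  "norm N f = (\<Sum>k<N. (act ^^ k) f)"

lemma act_power_filt: "f \<in> filt n \<Longrightarrow> (act ^^ k) f \<in> filt n"
  by (induction k) (auto intro: act_filt)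

lemma norm_filt: "f \<in> filt n \<Longrightarrow> norm N f \<in> filt n"
  unfolding norm_def by (intro filt_sum act_power_filt)

lemma act_power_linear:
  "(act ^^ k) (f + g) = (act ^^ k) f + (act ^^ k) g"
  "(act ^^ k) (f - g) = (act ^^ k) f - (act ^^ k) g"
  "(act ^^ k) (of_int c * f) = of_int c * (act ^^ k) f"
  by (induction k) (simp_all add: act_add act_diff act_of_int)

lemma norm_linear:
  "norm N (f + g) = norm N f + norm N g"
  "norm N (f - g) = norm N f - norm N g"
  "norm N (of_int c * f) = of_int c * norm N f"
  by (simp_all add: norm_def act_power_linear sum.distrib sum_subtractf sum_distrib_left)

lemma norm_act:
  assumes "\<And>f. (act ^^ N) f = f"
  shows "norm N (act f - f) = 0"
proof -
  have "norm N (act f - f) = (\<Sum>k<N. (act ^^ Suc k) f - (act ^^ k) f)"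
    by (simp add: norm_def act_power_linear funpow_swap1)
  also have "\<dots> = (act ^^ N) f - f" using sum_lessThan_telescope[of "\<lambda>k. (act ^^ k) f" N] by simp
  finally show ?thesis by (simp add: assms)
qed

lemma norm_fixed:
  assumes "act f - f \<in> filt n"
  shows "norm N f - of_int (int N) * f \<in> filt n"
proof -
  have "(act ^^ k) f - f \<in> filt n" for k
  proof (induction k)
    case (Suc k)
    have "act ((act ^^ k) f - f) + (act f - f) \<in> filt n" by (intro filt_add act_filt Suc assms)
    then show ?case by (simp add: act_diff)
  qed simp
  then have "(\<Sum>k<N. (act ^^ k) f - f) \<in> filt n" by (intro filt_sum)
  then show ?thesis by (simp add: norm_def sum_subtractf)
qed

text \<open>
  In the orbit sum, the coefficient at \<open>vwwvww\<close> receives \<open>3\<close> from the test word itself. A power of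
  \<open>act\<close> contributes only if it preserves the multidegree, and then it fixes both vertices and its
  signs cancel, so it contributes \<open>3\<close> again. Nothing can cancel. The coefficient at this word is well
  defined in the quotient because its two letters are not adjacent.
\<close>

lemma norm_test_word:
  assumes vw: "v \<in> V" "w \<in> V" "v \<noteq> w" "(v, w) \<notin> E" and "N > 0"
  shows "norm N (magnus (test_word v w) - 1) \<notin> filt 7"
proof
  let ?f = "magnus (test_word v w) - 1" and ?u = "[v, w, w, v, w, w]"
  have nonneg: "coeff ((act ^^ k) ?f) ?u \<ge> 0" for k
  proof -
    obtain s where s: "\<And>x. s x = 1 \<or> s x = (- 1 :: int)"
      "\<And>f u. coeff ((act ^^ k) f) u = prod_list (map s u) * coeff f (map (\<rho> ^^ k) u)"
      using coeff_act_power[of k] by auto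
    let ?p = "(\<rho> ^^ k) v" and ?q = "(\<rho> ^^ k) w"
    have sgn: "prod_list (map s ?u) = 1" using s(1)[of v] s(1)[of w] by auto
    show ?thesis
    proof (cases "coeff ?f (map (\<rho> ^^ k) ?u) = 0")
      case False
      have "\<forall>u. length u = size {#v, v, w, w, w, w#} \<longrightarrow> coeff ?f u \<noteq> 0 \<longrightarrow> mset u = {#v, v, w, w, w, w#}"
        using leading_degree_test_word[OF vw(3)] unfolding leading_degree_def by (rule conjunct2)
      moreover have "length (map (\<rho> ^^ k) ?u) = size {#v, v, w, w, w, w#}" by simp
      ultimately have m: "mset (map (\<rho> ^^ k) ?u) = {#v, v, w, w, w, w#}" using False by blast
      have "count (mset (map (\<rho> ^^ k) ?u)) v = 2" unfolding m using vw(3) by simp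
      then have "?p = v" "?q \<noteq> v" by (auto split: if_splits)
      moreover have "count (mset (map (\<rho> ^^ k) ?u)) w = 4" unfolding m using vw(3) by simp
      then have "?q = w" by (auto split: if_splits)
      ultimately have "coeff ?f (map (\<rho> ^^ k) ?u) = 3" using coeff_test_word[OF vw(3)] by simp
      then show ?thesis unfolding s(2) sgn by simp
    qed (simp only: s(2) mult_zero_right order_refl)
  qed
  have three: "coeff ((act ^^ 0) ?f) ?u = 3"
    unfolding funpow_0 by (rule coeff_test_word[OF vw(3)])
  have "coeff ((act ^^ 0) ?f) ?u \<le> (\<Sum>k<N. coeff ((act ^^ k) ?f) ?u)"
    using nonneg \<open>N > 0\<close> by (intro member_le_sum) auto
  then have pos: "coeff (norm N ?f) ?u \<noteq> 0" unfolding norm_def coeff_sum three by linarith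
  have "(x, y) \<notin> E" if "?u = s @ x # y # t" for s x y t
  proof -
    have "x \<in> {v, w}" "y \<in> {v, w}" using arg_cong[OF that, of set] by auto
    then show ?thesis using vw E_irrefl E_sym by auto
  qed
  moreover assume "norm N ?f \<in> filt 7"
  ultimately have "coeff (norm N ?f) ?u = 0" using vw by (intro filt_coeff) auto
  with pos show False ..
qed

lemma power_leading:
  assumes "h \<in> filt c" "c > 0"
  shows "(1 + h) ^ i - 1 - of_int (int i) * h \<in> filt (Suc c)"
proof (induction i)
  case (Suc i)
  have hh: "h * h \<in> filt (Suc c)" using filt_mult[OF assms(1,1)] by (rule filt_mono) (use assms in simp)
  have "(1 + h) ^ Suc i - 1 - of_int (int (Suc i)) * h
    = (1 + h) * ((1 + h) ^ i - 1 - of_int (int i) * h) + of_int (int i) * (h * h)"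
    by (simp add: algebra_simps mult_of_nat_commute)
  then show ?case using filt_add filt_mult_left Suc hh by presburger
qed simp

lemma magnus_power: "magnus (concat (replicate i a)) = magnus a ^ i"
  by (induction i) auto

text \<open>
  Let \<open>c\<close> be the least degree in which some group element has a leading part with nonzero orbit sum,
  and let \<open>a\<close> be such an element with leading part \<open>h\<close>. If \<open>g\<close> conjugates \<open>a ^ j\<close> to
  \<open>a ^ i\<close> in the twisted sense, then \<open>g\<close> lies in the \<open>c\<close>-th step of the filtration: in lower
  degrees the leading part \<open>f\<close> of \<open>g\<close> would be fixed by \<open>act\<close>, so that \<open>N f\<close> is its orbit sum,
  which vanishes by the choice of \<open>c\<close>. In degree \<open>c\<close> the equation reads
  \<open>(i - j) h = f - act f\<close>, and taking orbit sums gives \<open>i = j\<close>.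
\<close>

lemma twisted_classes_of_powers:
  fixes p :: "'a \<Rightarrow> 'a word"
  defines "Y \<equiv> \<lambda>v. magnus (p v) - 1"
  assumes lin: "\<And>a v. a \<in> V \<Longrightarrow> v \<in> V \<Longrightarrow> coeff (Y v) [a] = (if a = \<pi> v then \<epsilon> v else 0)"
    and comm: "\<And>x y n. (x, y) \<in> E \<Longrightarrow> Y x * Y y - Y y * Y x \<in> filt n"
    and vw: "v \<in> V" "w \<in> V" "v \<noteq> w" "(v, w) \<notin> E"
  obtains a where "a \<in> words_over V"
    "\<And>i j g. g \<in> words_over V \<Longrightarrow>
      (concat (replicate i a) @ word_subst p g, g @ concat (replicate j a)) \<in> pres_cong V relators \<Longrightarrow>
      i = j"
proof -
  obtain N where N: "N > 0" "\<And>f. (act ^^ N) f = f" using act_finite_order by auto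
  define P where "P n a \<longleftrightarrow> a \<in> words_over V \<and> magnus a - 1 \<in> filt n \<and> norm N (magnus a - 1) \<notin> filt (Suc n)"
    for n a
  define c where "c = (LEAST n. \<exists>a. P n a)"
  have "order_ge 6 (magnus (test_word v w) - 1)"
    using leading_degree_test_word[OF vw(3)] by (simp add: leading_degree_def eval_nat_numeral)
  then have "P 6 (test_word v w)"
    using norm_test_word[OF vw N(1)] test_word_words_over[OF vw(1,2)]
    by (simp add: P_def order_ge_filt eval_nat_numeral)
  then have "\<exists>n a. P n a" by blast
  then have "\<exists>a. P c a" unfolding c_def by (rule LeastI_ex)
  then obtain a where a: "a \<in> words_over V" "magnus a - 1 \<in> filt c" "norm N (magnus a - 1) \<notin> filt (Suc c)"
    by (auto simp: P_def)
  have min: "norm N (magnus g - 1) \<in> filt (Suc n)"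
    if "n < c" "g \<in> words_over V" "magnus g - 1 \<in> filt n" for n g
    using not_less_Least[of n "\<lambda>n. \<exists>a. P n a"] that by (auto simp: c_def P_def)
  have filt1: "magnus g - 1 \<in> filt (Suc 0)" for g by (simp add: filt_1 coeff_one)
  \<comment> \<open>Constant terms of Magnus images are one, so degree zero carries no leading part.\<close>
  have "c > 0" using a(3) norm_filt[OF filt1] by (cases c) auto
  have "i = j" if g: "g \<in> words_over V"
    and eq: "(concat (replicate i a) @ word_subst p g, g @ concat (replicate j a)) \<in> pres_cong V relators"
    for i j g
  proof (rule ccontr)
    assume "i \<noteq> j"
    define h where "h = magnus a - 1"
    define f where "f = magnus g - 1"
    define f' where "f' = subst V Y f"
    define r where "r i = (1 + h) ^ i - 1 - of_int (int i) * h" for i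
    let ?k = "of_int (int i - int j) :: 'a series"
    have h: "h \<in> filt c" using a(2) by (simp add: h_def)
    have Y0: "coeff (Y v) [] = 0" for v by (simp add: Y_def coeff_one)
    have f': "magnus (word_subst p g) = 1 + f'"
      using magnus_word_subst[OF finite_V g, of p]
      by (simp add: f'_def f_def subst_diff subst_one finite_V Y_def)
    have f1: "f \<in> filt (Suc 0)" and f'1: "f' \<in> filt (Suc 0)"
      using filt1[of g] filt1[of "word_subst p g"] f' by (auto simp: f_def)
    have r: "r i \<in> filt (Suc c)" for i unfolding r_def by (rule power_leading[OF h \<open>c > 0\<close>])
    have mag: "magnus a ^ i = 1 + of_int (int i) * h + r i" for i by (simp add: r_def h_def)
    have d: "magnus a ^ i * (1 + f') - (1 + f) * magnus a ^ j \<in> filt (Suc c)"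
      using magnus_cong[OF eq, of "Suc c"] f' by (simp add: magnus_power f_def)
    have hf: "h * f' \<in> filt (Suc c)" "f * h \<in> filt (Suc c)"
      using filt_mult[OF h f'1] filt_mult[OF f1 h] by auto
    have "f' - f + ?k * h = (magnus a ^ i * (1 + f') - (1 + f) * magnus a ^ j)
        - r i * (1 + f') + (1 + f) * r j - of_int (int i) * (h * f') + of_int (int j) * (f * h)"
      unfolding mag by (simp add: algebra_simps mult_of_nat_commute)
    also have "\<dots> \<in> filt (Suc c)"
      by (intro filt_add filt_diff filt_mult_left filt_mult_right d r hf)
    \<comment> \<open>Everything but the leading terms has been absorbed: products of two terms of positive order
      are negligible, since one factor has order at least \<open>c\<close>.\<close>
    finally have main: "f' - f + ?k * h \<in> filt (Suc c)" .
    have lead: "f' - act f \<in> filt (Suc n)" if "f \<in> filt n" for n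
      unfolding f'_def by (rule subst_leading[OF Y0 lin comm that])
    have "f \<in> filt n" if "n \<le> c" for n
      using that
    proof (induction n)
      case (Suc n)
      then have fn: "f \<in> filt n" by simp
      have "(f' - f + ?k * h) - (f' - act f) - ?k * h \<in> filt (Suc n)"
        using Suc.prems by (intro filt_diff lead[OF fn] filt_mult_left filt_mono[OF h] filt_mono[OF main]) auto
      then have "act f - f \<in> filt (Suc n)" by (simp add: algebra_simps)
      note fixed = norm_fixed[OF this, of N]
      have "norm N f \<in> filt (Suc n)"
        unfolding f_def by (rule min) (use Suc.prems g fn in \<open>auto simp: f_def\<close>)
      from filt_diff[OF this fixed]
      have "of_int (int N) * f \<in> filt (Suc n)" by simp
      then show ?case by (rule filt_torsion_free) (use N(1) in simp)
    qed simp
    then have "f \<in> filt c" by simp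
    then have "(f' - f + ?k * h) - (f' - act f) \<in> filt (Suc c)"
      by (intro filt_diff main lead)
    then have "(act f - f) + ?k * h \<in> filt (Suc c)" by (simp add: algebra_simps)
    from norm_filt[OF this, of N] have "?k * norm N h \<in> filt (Suc c)"
      by (simp only: norm_linear(1,3) norm_act[OF N(2)] add_0)
    then have "norm N h \<in> filt (Suc c)" by (rule filt_torsion_free) (use \<open>i \<noteq> j\<close> in simp)
    then show False using a(3) by (simp add: h_def)
  qed
  with a(1) show thesis by (rule that)
qed

end

section \<open>Automorphisms of the right-angled Artin group\<close>

context commutation_graph
begin

abbreviation A :: "'a word set monoid" where
  "A \<equiv> presented_group V relators"

definition cls :: "'a word \<Rightarrow> 'a word set" where
  "cls w = pres_cong V relators `` {w}"

lemma cls_carrier [simp]: "w \<in> words_over V \<Longrightarrow> cls w \<in> carrier A"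
  by (auto simp: cls_def presented_group_def quotient_def)

lemma carrier_cls:
  assumes "x \<in> carrier A"
  obtains w where "w \<in> words_over V" "x = cls w"
  using assms by (auto simp: cls_def presented_group_def quotient_def)

lemma cls_eq: "u \<in> words_over V \<Longrightarrow> v \<in> words_over V \<Longrightarrow> cls u = cls v \<longleftrightarrow> (u, v) \<in> pres_cong V relators"
  unfolding cls_def by (rule eq_equiv_class_iff[OF equiv_pres_cong])

lemma cls_mult: "u \<in> words_over V \<Longrightarrow> v \<in> words_over V \<Longrightarrow> cls u \<otimes>\<^bsub>A\<^esub> cls v = cls (u @ v)"
  unfolding cls_def by (rule presented_group_mult_class)

lemma cls_Nil: "cls [] = \<one>\<^bsub>A\<^esub>"
  by (simp add: cls_def presented_group_def)

lemma words_over_append [simp]: "u @ v \<in> words_over V \<longleftrightarrow> u \<in> words_over V \<and> v \<in> words_over V"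
  and words_over_Nil [simp]: "[] \<in> words_over V"
  and words_over_Cons: "(x, b) # w \<in> words_over V \<longleftrightarrow> x \<in> V \<and> w \<in> words_over V"
  by (auto simp: words_over_def)

lemma cls_inv: "w \<in> words_over V \<Longrightarrow> inv\<^bsub>A\<^esub> cls w = cls (inv_word w)"
proof -
  assume w: "w \<in> words_over V"
  interpret group A by (rule presented_group_is_group)
  have "cls (inv_word w @ w) = cls []"
    using presented_group_inverse_word[OF w, of relators] w by (simp add: cls_eq inv_word_def[symmetric])
  then have "cls (inv_word w) \<otimes>\<^bsub>A\<^esub> cls w = \<one>\<^bsub>A\<^esub>" using w by (simp add: cls_mult cls_Nil)
  then show ?thesis using w by (intro inv_equality) auto
qed

lemma hom_cls:
  assumes \<phi>: "\<phi> \<in> hom A A"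
    and p: "\<And>v. v \<in> V \<Longrightarrow> p v \<in> words_over V" "\<And>v. v \<in> V \<Longrightarrow> \<phi> (cls [(v, True)]) = cls (p v)"
    and w: "w \<in> words_over V"
  shows "\<phi> (cls w) = cls (word_subst p w)"
proof -
  interpret group A by (rule presented_group_is_group)
  interpret group_hom A A \<phi> by unfold_locales (rule \<phi>)
  show ?thesis using w
  proof (induction w)
    case Nil
    then show ?case by (simp add: cls_Nil)
  next
    case (Cons l w)
    obtain x b where l: "l = (x, b)" by (cases l)
    have x: "x \<in> V" and w: "w \<in> words_over V" using Cons.prems by (auto simp: l words_over_Cons)
    have x1: "[(x, b)] \<in> words_over V" for b using x by (simp add: words_over_Cons)
    have wp: "word_subst p w \<in> words_over V" by (rule word_subst_words_over[OF p(1) w])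
    have letter: "\<phi> (cls [(x, b)]) = cls (if b then p x else inv_word (p x))"
    proof (cases b)
      case False
      have "cls [(x, False)] = inv\<^bsub>A\<^esub> cls [(x, True)]"
        using cls_inv[OF x1[of True]] by (simp add: inv_word_def)
      then have "\<phi> (cls [(x, False)]) = inv\<^bsub>A\<^esub> \<phi> (cls [(x, True)])"
        using x1[of True] by (simp only: hom_inv cls_carrier)
      then show ?thesis using False x by (simp add: p cls_inv)
    qed (use p(2)[OF x] in simp)
    have "\<phi> (cls (l # w)) = \<phi> (cls [(x, b)] \<otimes>\<^bsub>A\<^esub> cls w)"
      using cls_mult[OF x1 w] by (simp add: l)
    also have "\<dots> = \<phi> (cls [(x, b)]) \<otimes>\<^bsub>A\<^esub> \<phi> (cls w)" using x1 w by (intro hom_mult) auto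
    also have "\<dots> = cls (word_subst p (l # w))"
      unfolding letter Cons.IH[OF w] using x wp p(1)[OF x] by (simp add: l cls_mult)
    finally show ?case .
  qed
qed

definition linear_part :: "('a \<Rightarrow> 'a word) \<Rightarrow> 'a \<Rightarrow> 'a \<Rightarrow> int" where
  "linear_part p a v = coeff (magnus (p v) - 1) [a]"

text \<open>
  Adjacent generators commute in the group, hence so do their images; subtracting the constant terms
  does not change the commutator.
\<close>

lemma magnus_commute:
  assumes \<phi>: "\<phi> \<in> hom A A"
    and p: "\<And>v. v \<in> V \<Longrightarrow> p v \<in> words_over V" "\<And>v. v \<in> V \<Longrightarrow> \<phi> (cls [(v, True)]) = cls (p v)"
    and xy: "(x, y) \<in> E"
  shows "(magnus (p x) - 1) * (magnus (p y) - 1) - (magnus (p y) - 1) * (magnus (p x) - 1) \<in> filt n"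
proof -
  have V: "x \<in> V" "y \<in> V" using xy E_subset by auto
  let ?x = "(x, True)" and ?y = "(y, True)"
  have w: "[?x, ?y] \<in> words_over V" "[?y, ?x] \<in> words_over V"
    and w': "[(x, False), (y, False)] \<in> words_over V"
    using V by (auto simp: words_over_Cons)
  interpret group A by (rule presented_group_is_group)
  have "([?x, ?y, (x, False), (y, False)], []) \<in> pres_cong V relators"
    using xy V by (intro pres_cong.relator) (auto simp: relators_def words_over_Cons)
  then have "cls ([?x, ?y] @ [(x, False), (y, False)]) = cls []"
    by (subst cls_eq) (use V in \<open>auto simp: words_over_Cons\<close>)
  then have "cls [?x, ?y] \<otimes>\<^bsub>A\<^esub> inv\<^bsub>A\<^esub> cls [?y, ?x] = \<one>\<^bsub>A\<^esub>"
    using w w' by (simp only: cls_inv[OF w(2)] cls_mult inv_word_words_over cls_Nil)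
      (simp add: inv_word_def cls_mult cls_Nil[symmetric])
  then have "cls [?x, ?y] = cls [?y, ?x]"
    using w by (metis cls_carrier inv_closed inv_equality inv_inv)
  moreover have "\<phi> (cls [?x, ?y]) = cls (p x @ p y)" "\<phi> (cls [?y, ?x]) = cls (p y @ p x)"
    using hom_cls[OF \<phi> p w(1)] hom_cls[OF \<phi> p w(2)] by simp_all
  ultimately have "cls (p x @ p y) = cls (p y @ p x)" by simp
  then have "(p x @ p y, p y @ p x) \<in> pres_cong V relators"
    using p(1) V by (simp add: cls_eq)
  from magnus_cong[OF this, of n]
  have "magnus (p x) * magnus (p y) - magnus (p y) * magnus (p x) \<in> filt n" by simp
  then show ?thesis by (simp add: algebra_simps)
qed

text \<open>
  If two series without constant term commute modulo order three, then their linear parts commute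
  in degree two. For non-adjacent \<open>a\<close> and \<open>b\<close> the word \<open>ab\<close> is alone in its class, so its
  coefficient may be read off.
\<close>

lemma linear_part_commute:
  assumes comm: "(magnus (p x) - 1) * (magnus (p y) - 1) - (magnus (p y) - 1) * (magnus (p x) - 1) \<in> filt 3"
    and ab: "a \<in> V" "b \<in> V" "(a, b) \<notin> E"
  shows "linear_part p a x * linear_part p b y = linear_part p b x * linear_part p a y"
proof -
  have o: "order_ge 1 (magnus w - 1)" for w :: "'a word" by (simp add: order_ge_def coeff_one)
  have c: "coeff ((magnus u - 1) * (magnus v - 1)) [a, b] = coeff (magnus u - 1) [a] * coeff (magnus v - 1) [b]"
    for u v :: "'a word"
    using coeff_mult_leading[OF o o, of "[a, b]" u v] by (simp del: coeff_diff)
  have "(c, d) \<notin> E" if "[a, b] = s @ c # d # t" for s c d t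
    using that ab by (auto simp: Cons_eq_append_conv)
  then have "coeff ((magnus (p x) - 1) * (magnus (p y) - 1) - (magnus (p y) - 1) * (magnus (p x) - 1)) [a, b] = 0"
    using ab by (intro filt_coeff[OF comm]) auto
  then have "coeff (magnus (p x) - 1) [a] * coeff (magnus (p y) - 1) [b]
      - coeff (magnus (p y) - 1) [a] * coeff (magnus (p x) - 1) [b] = 0"
    unfolding coeff_diff[of "_ * _"] c .
  then show ?thesis unfolding linear_part_def by (simp add: mult.commute)
qed

lemma coeff_subst_single:
  assumes Y: "\<And>v. v \<in> V \<Longrightarrow> coeff (Y v) [] = 0"
  shows "coeff (subst V Y f) [a] = (\<Sum>t\<in>V. coeff f [t] * coeff (Y t) [a])"
proof -
  have short: "short_lists V 1 = insert [] ((\<lambda>v. [v]) ` V)"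
    by (auto simp: short_lists_def le_Suc_eq length_Suc_conv)
  have "coeff (subst V Y f) [a] = (\<Sum>t\<in>(\<lambda>v. [v]) ` V. coeff f t * coeff (monomial Y t) [a])"
    unfolding coeff_subst by (simp add: short[simplified] finite_V coeff_one image_iff)
  also have "\<dots> = (\<Sum>t\<in>V. coeff f [t] * coeff (monomial Y [t]) [a])"
    by (subst sum.reindex) (auto simp: inj_on_def)
  finally show ?thesis by simp
qed

text \<open>
  The chain rule at the origin for the composition of two substitutions.
\<close>

lemma linear_part_inverse:
  assumes \<phi>: "\<phi> \<in> hom A A"
    and p: "\<And>v. v \<in> V \<Longrightarrow> p v \<in> words_over V" "\<And>v. v \<in> V \<Longrightarrow> \<phi> (cls [(v, True)]) = cls (p v)"
    and q: "\<And>v. v \<in> V \<Longrightarrow> q v \<in> words_over V" "\<And>v. v \<in> V \<Longrightarrow> \<phi> (cls (q v)) = cls [(v, True)]"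
    and av: "a \<in> V" "v \<in> V"
  shows "(\<Sum>t\<in>V. linear_part p a t * linear_part q t v) = (if a = v then 1 else 0)"
proof -
  have wv: "[(v, True)] \<in> words_over V" using av by (simp add: words_over_Cons)
  have "cls (word_subst p (q v)) = cls [(v, True)]"
    using hom_cls[OF \<phi> p q(1)] q(2) av by simp
  then have "(word_subst p (q v), [(v, True)]) \<in> pres_cong V relators"
    using cls_eq[OF word_subst_words_over[OF p(1) q(1)[OF av(2)]] wv] by simp
  from magnus_cong[OF this] have "coeff (magnus (word_subst p (q v)) - magnus [(v, True)]) [a] = 0"
    using av by (intro filt_coeff[where n = 2]) auto
  moreover have "coeff (magnus (word_subst p (q v))) [a]
    = (\<Sum>t\<in>V. coeff (magnus (q v)) [t] * coeff (magnus (p t) - 1) [a])"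
    unfolding magnus_word_subst[OF finite_V q(1)[OF av(2)]]
    by (rule coeff_subst_single) (simp add: coeff_one)
  ultimately show ?thesis
    by (simp add: linear_part_def coeff_one coeff_var mult.commute)
qed

text \<open>
  The first assumption, that no vertex lies below another one, turns the linear part of the
  automorphism into a signed graph symmetry, after which the powers of one suitable element are
  pairwise not twisted conjugate.
\<close>

lemma infinitely_many_twisted_classes:
  assumes free: "\<And>v w. v \<in> V \<Longrightarrow> w \<in> V \<Longrightarrow> v \<noteq> w \<Longrightarrow> \<exists>u. (v, u) \<in> E \<and> u \<noteq> w \<and> (w, u) \<notin> E"
    and vw: "v \<in> V" "w \<in> V" "v \<noteq> w" "(v, w) \<notin> E"
    and \<phi>: "\<phi> \<in> auto A"
  shows "infinite (carrier A // twisted_conj A \<phi>)"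
proof -
  interpret group A by (rule presented_group_is_group)
  have hom: "\<phi> \<in> hom A A" and bij: "bij_betw \<phi> (carrier A) (carrier A)"
    using \<phi> by (auto simp: auto_def Bij_def)
  interpret group_hom A A \<phi> by unfold_locales (rule hom)
  define \<psi> where "\<psi> = inv_into (carrier A) \<phi>"
  have hom': "\<psi> \<in> hom A A"
    using iso_set_sym[of \<phi> A] hom bij by (simp add: \<psi>_def iso_def)
  have \<phi>\<psi>: "\<phi> (\<psi> x) = x" and \<psi>\<phi>: "\<psi> (\<phi> x) = x" if "x \<in> carrier A" for x
    using that bij by (simp_all add: \<psi>_def bij_betw_inv_into_left bij_betw_inv_into_right)
  have letter: "cls [(v, True)] \<in> carrier A" if "v \<in> V" for v
    using that by (simp add: words_over_Cons)
  have "\<forall>v\<in>V. \<exists>w. w \<in> words_over V \<and> \<phi> (cls [(v, True)]) = cls w"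
    using letter hom_closed by (meson carrier_cls)
  then obtain p where p: "\<And>v. v \<in> V \<Longrightarrow> p v \<in> words_over V"
    "\<And>v. v \<in> V \<Longrightarrow> \<phi> (cls [(v, True)]) = cls (p v)" by metis
  have "\<forall>v\<in>V. \<exists>w. w \<in> words_over V \<and> \<psi> (cls [(v, True)]) = cls w"
    using letter hom' by (meson carrier_cls hom_in_carrier)
  then obtain q where q: "\<And>v. v \<in> V \<Longrightarrow> q v \<in> words_over V"
    "\<And>v. v \<in> V \<Longrightarrow> \<psi> (cls [(v, True)]) = cls (q v)" by metis
  have pq: "\<phi> (cls (q v)) = cls [(v, True)]" "\<psi> (cls (p v)) = cls [(v, True)]" if "v \<in> V" for v
    using \<phi>\<psi>[OF letter[OF that]] \<psi>\<phi>[OF letter[OF that]] p(2)[OF that] q(2)[OF that] by simp_all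
  obtain \<pi> \<epsilon> where sym: "signed_symmetry V E \<pi> \<epsilon>"
    and lin: "\<And>a v. a \<in> V \<Longrightarrow> v \<in> V \<Longrightarrow> linear_part p a v = (if a = \<pi> v then \<epsilon> v else 0)"
    using inverse_pair_signed_permutation[OF free
        linear_part_inverse[OF hom p q(1) pq(1)] linear_part_inverse[OF hom' q p(1) pq(2)]
        linear_part_commute[OF magnus_commute[OF hom p]]
        linear_part_commute[OF magnus_commute[OF hom' q]]]
    by blast
  interpret signed_symmetry V E \<pi> \<epsilon> by (rule sym)
  obtain a where a: "a \<in> words_over V"
    "\<And>i j g. g \<in> words_over V \<Longrightarrow>
      (concat (replicate i a) @ word_subst p g, g @ concat (replicate j a)) \<in> pres_cong V relators \<Longrightarrow>
      i = j"
    using twisted_classes_of_powers[OF lin[unfolded linear_part_def] magnus_commute[OF hom p] vw]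
    by blast
  define x where "x i = cls (concat (replicate i a))" for i
  have pow: "concat (replicate i a) \<in> words_over V" for i using a(1) by (induction i) auto
  have x: "x i \<in> carrier A" for i by (simp add: x_def pow)
  have separate: "i = j" if "(x i, x j) \<in> twisted_conj A \<phi>" for i j
  proof -
    from that obtain y where y: "y \<in> carrier A" "x i = y \<otimes>\<^bsub>A\<^esub> x j \<otimes>\<^bsub>A\<^esub> inv\<^bsub>A\<^esub> \<phi> y"
      by (auto simp: twisted_conj_def)
    obtain g where g: "g \<in> words_over V" "y = cls g" using y(1) by (rule carrier_cls)
    have \<phi>g: "\<phi> y = cls (word_subst p g)" "word_subst p g \<in> words_over V"
      using hom_cls[OF hom p g(1)] word_subst_words_over[OF p(1) g(1)] by (auto simp: g(2))
    have "x i \<otimes>\<^bsub>A\<^esub> \<phi> y = y \<otimes>\<^bsub>A\<^esub> x j" using y x by (simp add: m_assoc)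
    then have "cls (concat (replicate i a) @ word_subst p g) = cls (g @ concat (replicate j a))"
      using pow \<phi>g g by (simp add: x_def cls_mult)
    then show "i = j" using pow \<phi>g g by (intro a(2)[OF g(1)]) (simp add: cls_eq)
  qed
  have refl: "(x j, x j) \<in> twisted_conj A \<phi>" for j
    using x[of j] unfolding twisted_conj_def by (auto intro!: bexI[of _ "\<one>\<^bsub>A\<^esub>"])
  have "inj (\<lambda>i. twisted_conj A \<phi> `` {x i})"
  proof (rule injI)
    fix i j assume "twisted_conj A \<phi> `` {x i} = twisted_conj A \<phi> `` {x j}"
    then have "x j \<in> twisted_conj A \<phi> `` {x i}" using refl[of j] by auto
    then show "i = j" by (intro separate) auto
  qed
  then have "infinite (range (\<lambda>i. twisted_conj A \<phi> `` {x i}))" by (rule range_inj_infinite)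
  moreover have "range (\<lambda>i. twisted_conj A \<phi> `` {x i}) \<subseteq> carrier A // twisted_conj A \<phi>"
    using x by (auto intro: quotientI)
  ultimately show ?thesis using finite_subset by blast
qed

end

theorem corollary3p3p22:
  fixes \<Gamma> :: "'a pair_pre_digraph"
  assumes "pair_graph \<Gamma>"
    and "pverts \<Gamma> \<noteq> {}"
    and "transvection_free \<Gamma>"
  shows "R_infinity_property (raag \<Gamma>)"
proof -
  interpret pair_graph \<Gamma> by (rule assms(1))
  interpret graph: commutation_graph "pverts \<Gamma>" "parcs \<Gamma>"
  proof
    show "parcs \<Gamma> \<subseteq> pverts \<Gamma> \<times> pverts \<Gamma>" using arc_fst_in_verts arc_snd_in_verts by fastforce
    show "(y, x) \<in> parcs \<Gamma>" if "(x, y) \<in> parcs \<Gamma>" for x y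
      using pair_sym_arcs that by (auto simp: symmetric_def elim: symE)
    show "(x, x) \<notin> parcs \<Gamma>" for x using pair_no_loops by fastforce
  qed simp
  have free: "\<exists>u. (v, u) \<in> parcs \<Gamma> \<and> u \<noteq> w \<and> (w, u) \<notin> parcs \<Gamma>"
    if "v \<in> pverts \<Gamma>" "w \<in> pverts \<Gamma>" "v \<noteq> w" for v w
  proof -
    have "\<not> vertex_le \<Gamma> v w"
      using assms(3) that by (auto simp: transvection_free_def transvection_free_vertex_def)
    then show ?thesis by (auto simp: vertex_le_def star_def link_def)
  qed
  obtain v where v: "v \<in> pverts \<Gamma>" using assms(2) by auto
  have "pverts \<Gamma> \<noteq> {v}" using assms(3) by (auto simp: transvection_free_def)
  then obtain w where w: "w \<in> pverts \<Gamma>" "v \<noteq> w" using v by auto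
  \<comment> \<open>Since \<open>v\<close> is not below \<open>w\<close>, some neighbour of \<open>v\<close> is a vertex different from and
    not adjacent to \<open>w\<close>, which gives the pair for the test word.\<close>
  obtain u where u: "(v, u) \<in> parcs \<Gamma>" "u \<noteq> w" "(w, u) \<notin> parcs \<Gamma>" using free[OF v w] by auto
  then have uV: "u \<in> pverts \<Gamma>" using graph.E_subset by auto
  have raag: "raag \<Gamma> = graph.A" by (simp add: raag_def graph.relators_def)
  show ?thesis
    unfolding R_infinity_property_def reidemeister_number_def raag
    using graph.infinitely_many_twisted_classes[OF free w(1) uV u(2)[symmetric] u(3)] by simp
qed

end
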